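(* Consider Protocol 1 in which Alice's quantum states reach honest Bob through a noisy channel, modelled by a completely positive trace-preserving map $\mathcal E$. Let the channel fidelity be \[ f^0=\tfrac12\sum_{a\in\{0,1\}}\langle\psi_a|\mathcal E(|\psi_a\rangle\langle\psi_a|)|\psi_a\rangle , \] and suppose the threshold satisfies $0<f^*<f^0$. Fix $\theta\in(0,\pi/2]$ independently of $n$. Then the protocol is correct with $\delta_n\le\exp(-n(f^0-f^* )^2/2)$. Moreover, optimizing over all quantum strategies of the dishonest party, as $n\to\infty$: \[ \epsilon_A\le \frac{\sqrt{1-f^*}}{\sqrt2\sin^2\theta}+\frac{1-f^*}{\sin^2\theta}+O\Big(\sqrt{\tfrac{\ln n}{n}}\Big), \qquad \epsilon_B\le\frac{\sin\theta}{2}, \] \[ H_A\ge -n\log_2\Big[\tfrac12+\frac{\sqrt{1-f^*}}{\sqrt2\sin^2\theta}+\frac{1-f^*}{\sin^2\theta}\Big]-O(\sqrt{n\ln n}), \qquad H_B\ge n\,h\Big(\tfrac12(1+\sin\theta)\Big), \] where $h(p)=-p\log_2p-(1-p)\log_2(1-p)$.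
   Context: Protocol 1 (parameters $n\ge1$, $\theta\in(0,\pi/2]$, $f^*\in(0,1]$). Let $|\psi_0\rangle,|\psi_1\rangle$ be pure states with $|\langle\psi_0|\psi_1\rangle|^2=\cos^2\theta$. For $i=1,\dots,n$ in sequence: (a) Alice picks a uniformly random bit $a_i$, prepares $|\psi_{a_i}\rangle$ and sends it to Bob over the quantum channel. (b) Bob picks a uniformly random bit $b_i$ and announces it. (c) Alice announces $a_i$. (d) Bob measures the received system with the projective measurement $\{|\psi_{a_i}\rangle\langle\psi_{a_i}|,\ I-|\psi_{a_i}\rangle\langle\psi_{a_i}|\}$, setting $f_i=1$ for the first outcome and $f_i=0$ otherwise. At the end, Alice outputs $\mathbf x$ with $x_i=a_i\oplus b_i$. If $\sum_i f_i\ge nf^*$, Bob outputs $\mathbf y$ with $y_i=a_i\oplus b_i$; otherwise Bob aborts ($\mathbf y=\perp$). An honest party also aborts if the other visibly fails to follow the protocol (e.g. an expected message never arrives). Classical communication is noiseless. Cheating model. A dishonest party is limited only by quantum mechanics and controls everything outside the honest party's laboratory. In particular, they may replace the quantum channel by a noiseless one. - A dishonest Alice may prepare an arbitrary, possibly entangled, state of many systems, send one system per round, and choose each $a_i$ from adaptive quantum measurements on the systems she keeps. - A dishonest Bob may perform arbitrary measurements on the received systems and choose each $b_i$ adaptively. Correctness. The protocol is correct if, for every $\mathbf c\in\{0,1\}^n$ and honest strategies $H_A,H_B$, \[ (1-\delta_n)2^{-n}\le \mathrm P^{H_AH_B}(\mathbf x=\mathbf y=\mathbf c)\le(1+\delta_n)2^{-n}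 \] with $\delta_n\to0$. Average bias. With $S_A,S_B$ ranging over arbitrary strategies, \[ \tfrac12+\epsilon_A=\max_{S_A,\mathbf c}\frac1n\sum_i \mathrm P^{S_AH_B}(y_i=c_i), \qquad \tfrac12+\epsilon_B=\max_{S_B,\mathbf c}\frac1n\sum_i\mathrm P^{H_AS_B}(x_i=c_i), \] where an abort counts as $y_i\ne c_i$ (respectively $x_i\ne c_i$). Shannon entropy. For the entropy quantities, an honest party who would abort instead outputs a uniformly random $n$-bit string independent of everything else. Then \[ H_A=\min_{S_A}H(\mathrm P^{S_AH_B}(\mathbf y)), \qquad H_B=\min_{S_B}H(\mathrm P^{H_AS_B}(\mathbf x)), \] where $H$ is the Shannon entropy with base-2 logarithms.
   Formalization: A dishonest party is assumed to send every expected message (no refusal causing an abort), since selective refusal by Bob makes the stated bound on H_B fail; quantum systems are finite-dimensional (memories of any finite dimension). *)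

theory Defs
  imports "HOL-Analysis.Analysis"
begin

text \<open>A matrix is a function of row and column index; an r x c matrix is one
that vanishes outside the index range. A tensor index (i, k) in C^m (x) C^d is
encoded as i*d + k.\<close>

type_synonym cmat = "nat \<Rightarrow> nat \<Rightarrow> complex"
type_synonym cvec = "nat \<Rightarrow> complex"

definition mdim :: "nat \<Rightarrow> nat \<Rightarrow> cmat \<Rightarrow> bool" where
  "mdim r c A \<longleftrightarrow> (\<forall>i j. (r \<le> i \<or> c \<le> j) \<longrightarrow> A i j = 0)"

definition mmul :: "nat \<Rightarrow> cmat \<Rightarrow> cmat \<Rightarrow> cmat" where
  "mmul k A B = (\<lambda>i j. \<Sum>l<k. A i l * B l j)"

definition adj :: "cmat \<Rightarrow> cmat" where
  "adj A = (\<lambda>i j. cnj (A j i))"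

definition idm :: "nat \<Rightarrow> cmat" where
  "idm d = (\<lambda>i j. if i = j \<and> i < d then 1 else 0)"

definition kron :: "nat \<Rightarrow> nat \<Rightarrow> cmat \<Rightarrow> cmat \<Rightarrow> cmat" where
  "kron r c A B = (\<lambda>i j. A (i div r) (j div c) * B (i mod r) (j mod c))"

definition mtrace :: "nat \<Rightarrow> cmat \<Rightarrow> complex" where
  "mtrace d A = (\<Sum>i<d. A i i)"

definition ptrace2 :: "nat \<Rightarrow> cmat \<Rightarrow> cmat" where
  "ptrace2 d X = (\<lambda>i j. \<Sum>k<d. X (i * d + k) (j * d + k))"

definition vinner :: "nat \<Rightarrow> cvec \<Rightarrow> cvec \<Rightarrow> complex" where
  "vinner d u v = (\<Sum>i<d. cnj (u i) * v i)"

definition unitvec :: "nat \<Rightarrow> cvec \<Rightarrow> bool" where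
  "unitvec d v \<longleftrightarrow> (\<forall>i. d \<le> i \<longrightarrow> v i = 0) \<and> (\<Sum>i<d. (cmod (v i))\<^sup>2) = 1"

definition proj :: "cvec \<Rightarrow> cmat" where
  "proj v = (\<lambda>i j. v i * cnj (v j))"

definition quadform :: "nat \<Rightarrow> cmat \<Rightarrow> cvec \<Rightarrow> complex" where
  "quadform d A v = (\<Sum>i<d. \<Sum>j<d. cnj (v i) * A i j * v j)"

definition density :: "nat \<Rightarrow> cmat \<Rightarrow> bool" where
  "density d \<rho> \<longleftrightarrow> mdim d d \<rho> \<and>
     (\<forall>v. Im (quadform d \<rho> v) = 0 \<and> 0 \<le> Re (quadform d \<rho> v)) \<and> mtrace d \<rho> = 1"

definition kraus_sum :: "nat \<Rightarrow> cmat list \<Rightarrow> cmat" where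
  "kraus_sum dout Ks = (\<lambda>i j. \<Sum>K\<leftarrow>Ks. mmul dout (adj K) K i j)"

definition cptp :: "nat \<Rightarrow> nat \<Rightarrow> cmat list \<Rightarrow> bool" where
  "cptp din dout Ks \<longleftrightarrow> (\<forall>K\<in>set Ks. mdim dout din K) \<and> kraus_sum dout Ks = idm din"

definition instrument2 :: "nat \<Rightarrow> nat \<Rightarrow> (bool \<Rightarrow> cmat list) \<Rightarrow> bool" where
  "instrument2 din dout Kf \<longleftrightarrow> (\<forall>r. \<forall>K\<in>set (Kf r). mdim dout din K) \<and>
     (\<lambda>i j. kraus_sum dout (Kf False) i j + kraus_sum dout (Kf True) i j) = idm din"

definition kapply :: "nat \<Rightarrow> cmat list \<Rightarrow> cmat \<Rightarrow> cmat" where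
  "kapply din Ks \<rho> = (\<lambda>i j. \<Sum>K\<leftarrow>Ks. mmul din (mmul din K \<rho>) (adj K) i j)"

definition bproj :: "nat \<Rightarrow> (bool \<Rightarrow> cvec) \<Rightarrow> bool \<Rightarrow> bool \<Rightarrow> cmat" where
  "bproj d \<psi> a f = (if f then proj (\<psi> a) else (\<lambda>i j. idm d i j - proj (\<psi> a) i j))"

text \<open>Transcript of a round: (a_i, b_i, f_i); transcripts are chronological lists.\<close>
type_synonym round = "bool \<times> bool \<times> bool"

definition transcripts :: "nat \<Rightarrow> round list set" where
  "transcripts n = {t. length t = n}"

definition xor_out :: "round list \<Rightarrow> bool list" where
  "xor_out t = map (\<lambda>(a, b, f). a \<noteq> b) t"

definition accepts :: "real \<Rightarrow> round list \<Rightarrow> bool" where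
  "accepts fstar t \<longleftrightarrow> real (length t) * fstar \<le> real (length (filter (\<lambda>(a, b, f). f) t))"

definition pass_prob :: "nat \<Rightarrow> (bool \<Rightarrow> cvec) \<Rightarrow> cmat list \<Rightarrow> bool \<Rightarrow> real" where
  "pass_prob d \<psi> EK a = Re (quadform d (kapply d EK (proj (\<psi> a))) (\<psi> a))"

definition chan_fid :: "nat \<Rightarrow> (bool \<Rightarrow> cvec) \<Rightarrow> cmat list \<Rightarrow> real" where
  "chan_fid d \<psi> EK = (pass_prob d \<psi> EK False + pass_prob d \<psi> EK True) / 2"

text \<open>Probability of a transcript when both parties are honest: a_i, b_i uniform,
f_i from Bob's measurement of E(|psi_a><psi_a|).\<close>
definition prob_honest :: "nat \<Rightarrow> (bool \<Rightarrow> cvec) \<Rightarrow> cmat list \<Rightarrow> round list \<Rightarrow> real" where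
  "prob_honest d \<psi> EK t = (\<Prod>(a, b, f)\<leftarrow>t.
      (1/4) * (if f then pass_prob d \<psi> EK a else 1 - pass_prob d \<psi> EK a))"

text \<open>P(x = y = c): honest Alice outputs a XOR b, honest Bob the same unless he aborts.\<close>
definition honest_xy :: "nat \<Rightarrow> (bool \<Rightarrow> cvec) \<Rightarrow> cmat list \<Rightarrow> real \<Rightarrow> nat \<Rightarrow> bool list \<Rightarrow> real" where
  "honest_xy d \<psi> EK fstar n c = (\<Sum>t\<in>transcripts n.
      prob_honest d \<psi> EK t * (if accepts fstar t \<and> xor_out t = c then 1 else 0))"

text \<open>General strategy: quantum memory C^m with initial state; in each round a
CPTP map from the memory to memory (x) sent system C^d (adaptive on the
classical history of (a,b) pairs, newest first), and after Bob's b_i a two-outcome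
instrument on the memory producing a_i. The channel is under Alice's control,
so it is noiseless without loss of generality.\<close>

record astrat =
  amem :: nat
  ainit :: cmat
  aprep :: "(bool \<times> bool) list \<Rightarrow> cmat list"
  ameas :: "(bool \<times> bool) list \<Rightarrow> bool \<Rightarrow> bool \<Rightarrow> cmat list"

definition valid_astrat :: "nat \<Rightarrow> astrat \<Rightarrow> bool" where
  "valid_astrat d S \<longleftrightarrow> 0 < amem S \<and> density (amem S) (ainit S) \<and>
     (\<forall>h. cptp (amem S) (amem S * d) (aprep S h)) \<and>
     (\<forall>h b. instrument2 (amem S) (amem S) (ameas S h b))"

text \<open>Unnormalised memory state conditioned on a history (newest round first).\<close>
fun stA :: "nat \<Rightarrow> (bool \<Rightarrow> cvec) \<Rightarrow> astrat \<Rightarrow> round list \<Rightarrow> cmat" where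
  "stA d \<psi> S [] = ainit S"
| "stA d \<psi> S ((a, b, f) # h) =
     (let m = amem S; hc = map (\<lambda>(a, b, f). (a, b)) h;
          X = kapply m (aprep S hc) (stA d \<psi> S h);
          Z = kapply (m * d) (map (\<lambda>K. kron d d K (idm d)) (ameas S hc b a)) X;
          P = kron d d (idm m) (bproj d \<psi> a f);
          W = mmul (m * d) (mmul (m * d) P Z) P
      in (\<lambda>i j. ptrace2 d W i j / 2))"

definition probA :: "nat \<Rightarrow> (bool \<Rightarrow> cvec) \<Rightarrow> astrat \<Rightarrow> round list \<Rightarrow> real" where
  "probA d \<psi> S t = Re (mtrace (amem S) (stA d \<psi> S (rev t)))"

text \<open>(1/n) sum_i P(y_i = c_i), an abort counting as y_i ~= c_i.\<close>
definition avgA :: "nat \<Rightarrow> (bool \<Rightarrow> cvec) \<Rightarrow> real \<Rightarrow> nat \<Rightarrow> astrat \<Rightarrow> bool list \<Rightarrow> real" where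
  "avgA d \<psi> fstar n S c = (1 / real n) * (\<Sum>i<n. \<Sum>t\<in>transcripts n.
      probA d \<psi> S t * (if accepts fstar t \<and> xor_out t ! i = c ! i then 1 else 0))"

text \<open>Distribution of Bob's output, an abort replaced by a uniform n-bit string.\<close>
definition ydistA :: "nat \<Rightarrow> (bool \<Rightarrow> cvec) \<Rightarrow> real \<Rightarrow> nat \<Rightarrow> astrat \<Rightarrow> bool list \<Rightarrow> real" where
  "ydistA d \<psi> fstar n S c = (\<Sum>t\<in>transcripts n.
      probA d \<psi> S t * (if accepts fstar t then (if xor_out t = c then 1 else 0) else 1 / 2 ^ n))"

text \<open>General strategy: quantum memory C^m with initial state; in round i, a
two-outcome instrument from memory (x) received system to memory producing b_i,
adaptive on the history of (a,b) pairs (newest first).\<close>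

record bstrat =
  bmem :: nat
  binit :: cmat
  binst :: "(bool \<times> bool) list \<Rightarrow> bool \<Rightarrow> cmat list"

definition valid_bstrat :: "nat \<Rightarrow> bstrat \<Rightarrow> bool" where
  "valid_bstrat d S \<longleftrightarrow> 0 < bmem S \<and> density (bmem S) (binit S) \<and>
     (\<forall>h. instrument2 (bmem S * d) (bmem S) (binst S h))"

fun stB :: "nat \<Rightarrow> (bool \<Rightarrow> cvec) \<Rightarrow> bstrat \<Rightarrow> (bool \<times> bool) list \<Rightarrow> cmat" where
  "stB d \<psi> S [] = binit S"
| "stB d \<psi> S ((a, b) # h) =
     (\<lambda>i j. kapply (bmem S * d) (binst S h b) (kron d d (stB d \<psi> S h) (proj (\<psi> a))) i j / 2)"

definition probB :: "nat \<Rightarrow> (bool \<Rightarrow> cvec) \<Rightarrow> bstrat \<Rightarrow> (bool \<times> bool) list \<Rightarrow> real" where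
  "probB d \<psi> S t = Re (mtrace (bmem S) (stB d \<psi> S (rev t)))"

definition xor_outB :: "(bool \<times> bool) list \<Rightarrow> bool list" where
  "xor_outB t = map (\<lambda>(a, b). a \<noteq> b) t"

definition transcriptsB :: "nat \<Rightarrow> (bool \<times> bool) list set" where
  "transcriptsB n = {t. length t = n}"

definition avgB :: "nat \<Rightarrow> (bool \<Rightarrow> cvec) \<Rightarrow> nat \<Rightarrow> bstrat \<Rightarrow> bool list \<Rightarrow> real" where
  "avgB d \<psi> n S c = (1 / real n) * (\<Sum>i<n. \<Sum>t\<in>transcriptsB n.
      probB d \<psi> S t * (if xor_outB t ! i = c ! i then 1 else 0))"

definition xdistB :: "nat \<Rightarrow> (bool \<Rightarrow> cvec) \<Rightarrow> nat \<Rightarrow> bstrat \<Rightarrow> bool list \<Rightarrow> real" where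
  "xdistB d \<psi> n S c = (\<Sum>t\<in>transcriptsB n.
      probB d \<psi> S t * (if xor_outB t = c then 1 else 0))"

definition ent_term :: "real \<Rightarrow> real" where
  "ent_term p = (if p = 0 then 0 else - p * log 2 p)"

definition shannon :: "('a \<Rightarrow> real) \<Rightarrow> 'a set \<Rightarrow> real" where
  "shannon P X = (\<Sum>x\<in>X. ent_term (P x))"

definition bin_ent :: "real \<Rightarrow> real" where
  "bin_ent p = ent_term p + ent_term (1 - p)"

definition bitstrings :: "nat \<Rightarrow> bool list set" where
  "bitstrings n = {c. length c = n}"

end

theory Submission
  imports "HOL-Probability.Hoeffding" Defs
begin

text \<open>
  Dishonest Alice: Bob's share of the joint state cannot depend on his bit \<open>b\<close>. If the rounds pass
  the test, that share is close to a mixture of \<open>\<psi>\<^sub>0\<close> and \<open>\<psi>\<^sub>1\<close> with weights given by the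
  distribution of \<open>a\<close>; comparing the two values of \<open>b\<close> bounds the cheating probability of a single
  round, conditioned on the past, by a concave function of the failure probability. Replacing this
  function by its tangent at \<open>1 - f\<^sup>*\<close>, of value \<open>G\<close> there, makes the bound linear. The number of
  correct guesses minus the sum of the linear bounds is then a supermartingale with bounded
  increments, which controls the average bias. For the entropy, the accepted transcripts whose
  conditional failure probabilities sum to at most \<open>n (1 - f\<^sup>*) + sqrt (n ln n)\<close> give every string
  probability at most \<open>G\<^sup>n exp (O (sqrt (n ln n)))\<close>, and by an Azuma--Hoeffding bound the other
  accepted transcripts have total weight at most \<open>1/n\<close>.

  Dishonest Bob: in each round he has to discriminate two pure states prepared independently of the
  past, so Helstrom's bound applies conditionally on the past, and the chain rule gives the entropy.
\<close>

subsection \<open>Matrices, traces and tensor indices\<close>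

lemma sum_prod_index: "(\<Sum>I<m * d. f I) = (\<Sum>i<m. \<Sum>k<d. f (i * d + k))"
  for f :: "nat \<Rightarrow> 'a::comm_monoid_add"
  by (simp add: sum_mult_product add.commute)

lemma sum_idm_left: "(\<Sum>j<m. idm m i j * f j) = (if i < m then f i else 0)"
proof -
  have "(\<Sum>j<m. idm m i j * f j) = (\<Sum>j<m. if i = j then f j else 0)"
    by (intro sum.cong) (auto simp: idm_def)
  then show ?thesis by simp
qed

lemma sum_idm_right: "(\<Sum>j<m. f j * idm m j i) = (if i < m then f i else 0)"
proof -
  have "idm m j i = idm m i j" for j by (auto simp: idm_def)
  then show ?thesis using sum_idm_left[of m i f] by (simp add: mult.commute)
qed

lemma adj_idm: "adj (idm d) = idm d"
  by (auto simp: adj_def idm_def fun_eq_iff)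

lemma mmul_idm_left: "mdim d n A \<Longrightarrow> mmul d (idm d) A = A"
  by (auto simp: mmul_def sum_idm_left mdim_def fun_eq_iff)

lemma mmul_idm_right: "mdim n d A \<Longrightarrow> mmul d A (idm d) = A"
  by (auto simp: mmul_def sum_idm_right mdim_def fun_eq_iff)

lemma mmul_assoc: "mmul k (mmul l A B) C = mmul l A (mmul k B C)"
proof (intro ext)
  fix i j
  have "mmul k (mmul l A B) C i j = (\<Sum>y<k. \<Sum>x<l. A i x * (B x y * C y j))"
    by (simp add: mmul_def sum_distrib_right mult.assoc)
  also have "\<dots> = mmul l A (mmul k B C) i j"
    unfolding mmul_def sum_distrib_left by (rule sum.swap)
  finally show "mmul k (mmul l A B) C i j = mmul l A (mmul k B C) i j" .
qed

lemma mmul_add_left: "mmul k (\<lambda>i j. A i j + B i j) C = (\<lambda>i j. mmul k A C i j + mmul k B C i j)"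
  by (simp add: mmul_def sum.distrib distrib_right)

lemma mmul_diff_left: "mmul k (\<lambda>i j. A i j - B i j) C = (\<lambda>i j. mmul k A C i j - mmul k B C i j)"
  by (simp add: mmul_def sum_subtractf left_diff_distrib)

lemma mmul_add_right: "mmul k A (\<lambda>i j. B i j + C i j) = (\<lambda>i j. mmul k A B i j + mmul k A C i j)"
  by (simp add: mmul_def sum.distrib distrib_left)

lemma mmul_diff_right: "mmul k A (\<lambda>i j. B i j - C i j) = (\<lambda>i j. mmul k A B i j - mmul k A C i j)"
  by (simp add: mmul_def sum_subtractf right_diff_distrib)

lemma mtrace_add: "mtrace d (\<lambda>i j. A i j + B i j) = mtrace d A + mtrace d B"
  by (simp add: mtrace_def sum.distrib)

lemma mtrace_diff: "mtrace d (\<lambda>i j. A i j - B i j) = mtrace d A - mtrace d B"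
  by (simp add: mtrace_def sum_subtractf)

lemma mtrace_divide: "mtrace d (\<lambda>i j. A i j / z) = mtrace d A / z"
  by (simp add: mtrace_def sum_divide_distrib)

lemma mtrace_mmul_commute: "mtrace n (mmul m A B) = mtrace m (mmul n B A)"
proof -
  have "mtrace n (mmul m A B) = (\<Sum>j<m. \<Sum>i<n. A i j * B j i)"
    unfolding mtrace_def mmul_def by (rule sum.swap)
  then show ?thesis by (simp add: mtrace_def mmul_def mult.commute)
qed

lemma mtrace_mmul_idm: "mtrace d (mmul d (idm d) A) = mtrace d A"
  by (simp add: mtrace_def mmul_def sum_idm_left)

lemma mtrace_mmul_cong:
  assumes "\<And>i j. i < d \<Longrightarrow> j < d \<Longrightarrow> B i j = C i j"
  shows "mtrace d (mmul d A B) = mtrace d (mmul d A C)"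
  unfolding mtrace_def mmul_def using assms by (intro sum.cong refl) simp

lemma adj_kron: "adj (kron r c A B) = kron c r (adj A) (adj B)"
  by (simp add: adj_def kron_def)

lemma mmul_kron: "mmul (m * d) (kron r d A B) (kron d c A' B') =
    kron r c (mmul m A A') (mmul d B B')"
proof (intro ext)
  fix i j
  have "mmul (m * d) (kron r d A B) (kron d c A' B') i j =
      (\<Sum>x<m. \<Sum>y<d. A (i div r) x * A' x (j div c) * (B (i mod r) y * B' y (j mod c)))"
    unfolding mmul_def sum_prod_index by (intro sum.cong refl) (simp add: kron_def mult_ac)
  then show "mmul (m * d) (kron r d A B) (kron d c A' B') i j =
      kron r c (mmul m A A') (mmul d B B') i j"
    by (simp add: kron_def mmul_def sum_product)
qed

subsection \<open>Kraus maps\<close>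

lemma kapply_Nil: "kapply m [] \<rho> = (\<lambda>i j. 0)"
  by (simp add: kapply_def)

lemma kapply_Cons:
  "kapply m (K # Ks) \<rho> = (\<lambda>i j. mmul m (mmul m K \<rho>) (adj K) i j + kapply m Ks \<rho> i j)"
  by (simp add: kapply_def)

lemma kraus_sum_Nil: "kraus_sum m [] = (\<lambda>i j. 0)"
  by (simp add: kraus_sum_def)

lemma kraus_sum_Cons:
  "kraus_sum m (K # Ks) = (\<lambda>i j. mmul m (adj K) K i j + kraus_sum m Ks i j)"
  by (simp add: kraus_sum_def)

lemma mtrace_kapply: "mtrace n (kapply m Ks \<rho>) = mtrace m (mmul m (kraus_sum n Ks) \<rho>)"
proof (induction Ks)
  case Nil
  then show ?case by (simp add: kapply_Nil kraus_sum_Nil mtrace_def mmul_def)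
next
  case (Cons K Ks)
  have "mtrace n (mmul m (mmul m K \<rho>) (adj K)) = mtrace m (mmul m (mmul n (adj K) K) \<rho>)"
    unfolding mtrace_mmul_commute[of n m _ "adj K"] by (simp only: mmul_assoc)
  then show ?case using Cons by (simp add: kapply_Cons kraus_sum_Cons mtrace_add mmul_add_left)
qed

lemma mtrace_kapply_cptp: "cptp m n Ks \<Longrightarrow> mtrace n (kapply m Ks \<rho>) = mtrace m \<rho>"
  by (simp add: mtrace_kapply cptp_def mtrace_mmul_idm)

lemma mtrace_kapply_instrument2:
  assumes "instrument2 m n Kf"
  shows "mtrace n (kapply m (Kf False) \<rho>) + mtrace n (kapply m (Kf True) \<rho>) = mtrace m \<rho>"
proof -
  have "mtrace n (kapply m (Kf False) \<rho>) + mtrace n (kapply m (Kf True) \<rho>) =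
      mtrace m (mmul m (\<lambda>i j. kraus_sum n (Kf False) i j + kraus_sum n (Kf True) i j) \<rho>)"
    by (simp add: mtrace_kapply mmul_add_left mtrace_add)
  also have "\<dots> = mtrace m \<rho>"
    using assms by (simp add: instrument2_def mtrace_mmul_idm)
  finally show ?thesis .
qed

subsection \<open>Quadratic forms and positive matrices\<close>

definition mvec :: "nat \<Rightarrow> cmat \<Rightarrow> cvec \<Rightarrow> cvec" where
  "mvec n A v = (\<lambda>i. \<Sum>j<n. A i j * v j)"

lemma vinner_commute: "vinner d u v = cnj (vinner d v u)"
  by (simp add: vinner_def mult.commute)

lemma vinner_self: "vinner d u u = of_real (\<Sum>i<d. (cmod (u i))\<^sup>2)"
  unfolding vinner_def of_real_sum by (intro sum.cong refl) (metis complex_norm_square mult.commute)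

lemma unitvec_iff: "unitvec d u \<longleftrightarrow> (\<forall>i\<ge>d. u i = 0) \<and> vinner d u u = 1"
  unfolding unitvec_def vinner_self of_real_eq_1_iff ..

lemma unitvec_vinner_self: "unitvec d u \<Longrightarrow> vinner d u u = 1"
  by (simp add: unitvec_iff)

lemma mtrace_proj: "mtrace d (proj v) = vinner d v v"
  by (simp add: mtrace_def proj_def vinner_def mult.commute)

lemma mmul_proj_proj: "mmul d (proj u) (proj v) = (\<lambda>i j. vinner d u v * (u i * cnj (v j)))"
proof (intro ext)
  fix i j
  show "mmul d (proj u) (proj v) i j = vinner d u v * (u i * cnj (v j))"
    unfolding mmul_def proj_def vinner_def sum_distrib_right
    by (intro sum.cong refl) (simp add: mult_ac)
qed

lemma proj_mvec: "mmul n (mmul n A (proj v)) (adj A) = proj (mvec n A v)"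
proof (intro ext)
  fix i j
  have "mmul n (mmul n A (proj v)) (adj A) i j = (\<Sum>y<n. \<Sum>x<n. (A i x * v x) * cnj (A j y * v y))"
    by (simp add: mmul_def proj_def adj_def sum_distrib_left sum_distrib_right mult_ac)
  also have "\<dots> = (\<Sum>x<n. \<Sum>y<n. (A i x * v x) * cnj (A j y * v y))"
    by (rule sum.swap)
  also have "\<dots> = proj (mvec n A v) i j"
    by (simp add: proj_def mvec_def sum_product)
  finally show "mmul n (mmul n A (proj v)) (adj A) i j = proj (mvec n A v) i j" .
qed

lemma quadform_eq_mtrace: "quadform d A v = mtrace d (mmul d (proj v) A)"
proof -
  have "quadform d A v = (\<Sum>j<d. \<Sum>i<d. cnj (v i) * A i j * v j)"
    unfolding quadform_def by (rule sum.swap)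
  then show ?thesis by (simp add: mtrace_def mmul_def proj_def mult_ac)
qed

lemma quadform_add: "quadform d (\<lambda>i j. A i j + B i j) v = quadform d A v + quadform d B v"
  by (simp add: quadform_eq_mtrace mmul_add_right mtrace_add)

lemma quadform_divide: "quadform d (\<lambda>i j. A i j / z) v = quadform d A v / z"
  by (simp add: quadform_def sum_divide_distrib)

lemma quadform_cong:
  assumes "\<And>i j. i < d \<Longrightarrow> j < d \<Longrightarrow> A i j = B i j"
  shows "quadform d A v = quadform d B v"
  unfolding quadform_def using assms by (intro sum.cong refl) simp

lemma mtrace_sum_cong:
  assumes "\<And>k l. k < d \<Longrightarrow> l < d \<Longrightarrow> A k l + B k l = C k l"
  shows "mtrace d A + mtrace d B = mtrace d C"
  unfolding mtrace_def sum.distrib[symmetric] using assms by (intro sum.cong refl) simp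

lemma quadform_sum_cong:
  assumes "\<And>k l. k < d \<Longrightarrow> l < d \<Longrightarrow> A k l + B k l = C k l"
  shows "quadform d A v + quadform d B v = quadform d C v"
  unfolding quadform_add[symmetric] using assms by (rule quadform_cong)

lemma quadform_scale: "quadform d A (\<lambda>i. z * v i) = of_real ((cmod z)\<^sup>2) * quadform d A v"
proof -
  have "proj (\<lambda>i. z * v i) = (\<lambda>i j. of_real ((cmod z)\<^sup>2) * proj v i j)"
    unfolding complex_norm_square by (simp add: proj_def mult_ac)
  then show ?thesis
    by (simp add: quadform_eq_mtrace mtrace_def mmul_def sum_distrib_left mult.assoc)
qed

lemma quadform_conjugate:
  "quadform n (mmul m (mmul m K \<rho>) (adj K)) v = quadform m \<rho> (mvec n (adj K) v)"
proof -
  have "quadform n (mmul m (mmul m K \<rho>) (adj K)) v =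
      mtrace n (mmul m (mmul n (proj v) (mmul m K \<rho>)) (adj K))"
    by (simp only: quadform_eq_mtrace mmul_assoc)
  also have "\<dots> = mtrace m (mmul m (mmul n (mmul n (adj K) (proj v)) K) \<rho>)"
    unfolding mtrace_mmul_commute[of n m _ "adj K"] by (simp only: mmul_assoc)
  also have "mmul n (mmul n (adj K) (proj v)) K = proj (mvec n (adj K) v)"
    using proj_mvec[of n "adj K" v] by (simp add: adj_def)
  finally show ?thesis by (simp only: quadform_eq_mtrace)
qed

text \<open>Only real parts are constrained: hermiticity is never needed.\<close>
definition psd :: "nat \<Rightarrow> cmat \<Rightarrow> bool" where
  "psd d A \<longleftrightarrow> (\<forall>v. 0 \<le> Re (quadform d A v))"

lemma density_psd: "density d \<rho> \<Longrightarrow> psd d \<rho>"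
  by (simp add: density_def psd_def)

lemma psd_divide: "psd d A \<Longrightarrow> 0 < z \<Longrightarrow> psd d (\<lambda>i j. A i j / of_real z)"
  by (simp add: psd_def quadform_divide)

lemma psd_cong: "psd d A \<Longrightarrow> (\<And>i j. i < d \<Longrightarrow> j < d \<Longrightarrow> A i j = B i j) \<Longrightarrow> psd d B"
  using quadform_cong[of d A B] by (simp add: psd_def)

lemma psd_kapply:
  assumes "psd m \<rho>"
  shows "psd n (kapply m Ks \<rho>)"
proof (induction Ks)
  case Nil
  then show ?case by (simp add: psd_def kapply_Nil quadform_def)
next
  case (Cons K Ks)
  then show ?case using assms by (simp add: psd_def kapply_Cons quadform_add quadform_conjugate)
qed

lemma psd_proj: "psd d (proj v)"
proof -
  have "quadform d (proj v) w = vinner d w v * cnj (vinner d w v)" for w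
    unfolding quadform_eq_mtrace mmul_proj_proj
    by (simp add: mtrace_def vinner_commute[of d w v] vinner_def sum_distrib_left mult_ac)
  then show ?thesis unfolding psd_def complex_norm_square[symmetric] by simp
qed

lemma psd_mtrace_nonneg:
  assumes "psd d A"
  shows "0 \<le> Re (mtrace d A)"
proof -
  have "Re (quadform d A (idm d i)) = Re (A i i)" if "i < d" for i
  proof -
    have "cnj (idm d i j) = idm d i j" for j by (simp add: idm_def)
    then have "quadform d A (idm d i) = (\<Sum>j<d. idm d i j * (\<Sum>k<d. idm d i k * A j k))"
      by (simp add: quadform_def sum_distrib_left mult_ac)
    then show ?thesis using that by (simp add: sum_idm_left)
  qed
  then have "Re (mtrace d A) = (\<Sum>i<d. Re (quadform d A (idm d i)))"
    by (simp add: mtrace_def)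
  also have "\<dots> \<ge> 0" using assms by (intro sum_nonneg) (simp add: psd_def)
  finally show ?thesis .
qed

lemma quadform_reindex:
  assumes inj: "inj_on f {..<d}" and range: "f ` {..<d} \<subseteq> {..<n}"
  shows "quadform d (\<lambda>k l. X (f k) (f l)) v =
    quadform n X (\<lambda>I. if I \<in> f ` {..<d} then v (inv_into {..<d} f I) else 0)"
    (is "_ = quadform n X ?w")
proof -
  have "quadform n X ?w = (\<Sum>I\<in>f ` {..<d}. \<Sum>J\<in>f ` {..<d}. cnj (?w I) * X I J * ?w J)"
    unfolding quadform_def using range
    by (intro sum.mono_neutral_cong_right) (auto intro!: sum.neutral sum.mono_neutral_right)
  also have "\<dots> = (\<Sum>k<d. \<Sum>l<d. cnj (v k) * X (f k) (f l) * v l)"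
    using inj by (simp add: sum.reindex)
  finally show ?thesis by (simp add: quadform_def)
qed

lemma psd_sum_reindex:
  assumes "psd n X"
    and "\<And>x. x \<in> S \<Longrightarrow> inj_on (f x) {..<d}" and "\<And>x. x \<in> S \<Longrightarrow> f x ` {..<d} \<subseteq> {..<n}"
  shows "psd d (\<lambda>k l. \<Sum>x\<in>S. X (f x k) (f x l))"
proof -
  have "quadform d (\<lambda>k l. \<Sum>x\<in>S. X (f x k) (f x l)) v =
      (\<Sum>x\<in>S. quadform d (\<lambda>k l. X (f x k) (f x l)) v)" for v
  proof -
    have "quadform d (\<lambda>k l. \<Sum>x\<in>S. X (f x k) (f x l)) v =
        (\<Sum>k<d. \<Sum>x\<in>S. \<Sum>l<d. cnj (v k) * X (f x k) (f x l) * v l)"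
      unfolding quadform_def sum_distrib_left sum_distrib_right
      by (rule sum.cong[OF refl], rule sum.swap)
    then show ?thesis unfolding quadform_def by (simp only: sum.swap[of _ S])
  qed
  moreover have "0 \<le> Re (quadform d (\<lambda>k l. X (f x k) (f x l)) v)" if "x \<in> S" for x v
    using assms(1) unfolding quadform_reindex[OF assms(2,3)[OF that]] psd_def by blast
  ultimately show ?thesis by (simp add: psd_def sum_nonneg)
qed

subsection \<open>Orthogonal projections\<close>

definition orth_proj :: "nat \<Rightarrow> cmat \<Rightarrow> bool" where
  "orth_proj d P \<longleftrightarrow> mdim d d P \<and> adj P = P \<and> mmul d P P = P"

lemma orth_proj_proj:
  assumes "unitvec d v"
  shows "orth_proj d (proj v)"
proof -
  have "mmul d (proj v) (proj v) = proj v"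
    unfolding mmul_proj_proj unitvec_vinner_self[OF assms] by (simp add: proj_def)
  then show ?thesis
    using assms by (auto simp: orth_proj_def mdim_def unitvec_def proj_def adj_def mult.commute)
qed

lemma orth_proj_idm: "orth_proj d (idm d)"
proof -
  have "mdim d d (idm d)" by (auto simp: mdim_def idm_def)
  then show ?thesis by (simp add: orth_proj_def adj_idm mmul_idm_left)
qed

lemma orth_proj_complement:
  assumes "orth_proj d P"
  shows "orth_proj d (\<lambda>i j. idm d i j - P i j)"
proof -
  have dims: "mdim d d P" "mdim d d (idm d)" and "adj P = P" "mmul d P P = P"
    using assms orth_proj_idm[of d] by (auto simp: orth_proj_def)
  then have "mmul d (\<lambda>i j. idm d i j - P i j) (\<lambda>i j. idm d i j - P i j) = (\<lambda>i j. idm d i j - P i j)"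
    by (simp add: mmul_diff_left mmul_diff_right mmul_idm_left mmul_idm_right)
  moreover have "adj (\<lambda>i j. idm d i j - P i j) = (\<lambda>i j. adj (idm d) i j - adj P i j)"
    by (simp add: adj_def)
  ultimately show ?thesis
    using dims \<open>adj P = P\<close> by (simp add: orth_proj_def mdim_def adj_idm)
qed

lemma orth_proj_add:
  assumes "orth_proj d P" "orth_proj d Q" "mmul d P Q = (\<lambda>i j. 0)" "mmul d Q P = (\<lambda>i j. 0)"
  shows "orth_proj d (\<lambda>i j. P i j + Q i j)"
proof -
  have "adj (\<lambda>i j. P i j + Q i j) = (\<lambda>i j. adj P i j + adj Q i j)"
    by (simp add: adj_def)
  then show ?thesis
    using assms by (simp add: orth_proj_def mdim_def mmul_add_left mmul_add_right)
qed

lemma orth_proj_kron_idm: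
  assumes "orth_proj d P"
  shows "orth_proj (m * d) (kron d d (idm m) P)"
proof -
  have "mdim (m * d) (m * d) (kron d d (idm m) P)"
  proof (cases "d = 0")
    case True
    then show ?thesis using assms by (simp add: orth_proj_def mdim_def kron_def)
  next
    case False
    then show ?thesis
      by (auto simp: mdim_def kron_def idm_def simp flip: less_eq_div_iff_mult_less_eq)
  qed
  then show ?thesis
    using assms orth_proj_idm[of m] by (simp add: orth_proj_def adj_kron mmul_kron)
qed

lemma orth_proj_conjugate:
  assumes "orth_proj n P"
  shows "mmul n (mmul n P X) P = kapply n [P] X"
    and "mtrace n (mmul n (mmul n P X) P) = mtrace n (mmul n P X)"
proof -
  show "mmul n (mmul n P X) P = kapply n [P] X"
    using assms by (simp add: orth_proj_def kapply_def)
  then show "mtrace n (mmul n (mmul n P X) P) = mtrace n (mmul n P X)"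
    using assms by (simp add: mtrace_kapply orth_proj_def kraus_sum_def)
qed

lemma orth_proj_mtrace_nonneg:
  assumes "orth_proj d P" "psd d A"
  shows "0 \<le> Re (mtrace d (mmul d P A))"
  using psd_mtrace_nonneg[OF psd_kapply[OF assms(2)]] orth_proj_conjugate[OF assms(1)] by metis

lemma quadform_le_mtrace:
  assumes "psd d A" "unitvec d u"
  shows "Re (quadform d A u) \<le> Re (mtrace d A)"
  using orth_proj_mtrace_nonneg[OF orth_proj_complement[OF orth_proj_proj[OF assms(2)]] assms(1)]
  by (simp add: mmul_diff_left mtrace_diff mtrace_mmul_idm quadform_eq_mtrace)

lemma quadform_orthonormal_pair_le_mtrace:
  assumes "psd d A" "unitvec d u" "unitvec d w" "vinner d u w = 0"
  shows "Re (quadform d A u) + Re (quadform d A w) \<le> Re (mtrace d A)"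
proof -
  have "vinner d w u = 0" using assms(4) vinner_commute[of d w u] by simp
  then have "orth_proj d (\<lambda>i j. proj u i j + proj w i j)"
    using assms by (intro orth_proj_add orth_proj_proj) (simp_all add: mmul_proj_proj)
  from orth_proj_mtrace_nonneg[OF orth_proj_complement[OF this] assms(1)] show ?thesis
    by (simp add: mmul_diff_left mmul_add_left mtrace_add mtrace_diff mtrace_mmul_idm
        quadform_eq_mtrace)
qed

subsection \<open>Partial traces\<close>

lemma tensor_index_less:
  fixes i k m d :: nat
  assumes "i < m" "k < d"
  shows "i * d + k < m * d"
proof -
  have "i * d + k < Suc i * d" using assms(2) by simp
  also have "\<dots> \<le> m * d" using assms(1) by (intro mult_right_mono) auto
  finally show ?thesis .
qed

definition block :: "nat \<Rightarrow> cmat \<Rightarrow> nat \<Rightarrow> nat \<Rightarrow> cmat" where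
  "block d X k l = (\<lambda>i j. X (i * d + k) (j * d + l))"

definition ptrace1 :: "nat \<Rightarrow> nat \<Rightarrow> cmat \<Rightarrow> cmat" where
  "ptrace1 m d X = (\<lambda>k l. mtrace m (block d X k l))"

lemma mtrace_ptrace1: "mtrace d (ptrace1 m d X) = mtrace (m * d) X"
  unfolding mtrace_def ptrace1_def block_def sum_prod_index by (rule sum.swap)

lemma mtrace_ptrace2: "mtrace m (ptrace2 d X) = mtrace (m * d) X"
  unfolding mtrace_def ptrace2_def sum_prod_index ..

lemma psd_ptrace1:
  assumes "psd (m * d) X"
  shows "psd d (ptrace1 m d X)"
  unfolding ptrace1_def mtrace_def block_def
  by (rule psd_sum_reindex[OF assms, where f = "\<lambda>i k. i * d + k"])
     (auto simp: inj_on_def tensor_index_less)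

lemma psd_ptrace2:
  assumes "psd (m * d) X"
  shows "psd m (ptrace2 d X)"
  unfolding ptrace2_def
  by (rule psd_sum_reindex[OF assms, where f = "\<lambda>k i. i * d + k"])
     (auto simp: inj_on_def tensor_index_less)

lemma mtrace_mmul_kron_idm:
  "mtrace (m * d) (mmul (m * d) (kron d d (idm m) B) Z) = mtrace d (mmul d B (ptrace1 m d Z))"
proof -
  have "mmul (m * d) (kron d d (idm m) B) Z (i * d + k) (i * d + k) =
      (\<Sum>l<d. B k l * Z (i * d + l) (i * d + k))" if "i < m" "k < d" for i k
  proof -
    have "mmul (m * d) (kron d d (idm m) B) Z (i * d + k) (i * d + k) =
        (\<Sum>j<m. idm m i j * (\<Sum>l<d. B k l * Z (j * d + l) (i * d + k)))"
      unfolding mmul_def sum_prod_index sum_distrib_left using that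
      by (intro sum.cong refl) (simp add: kron_def mult_ac)
    then show ?thesis using that by (simp add: sum_idm_left)
  qed
  then have "mtrace (m * d) (mmul (m * d) (kron d d (idm m) B) Z) =
      (\<Sum>i<m. \<Sum>k<d. \<Sum>l<d. B k l * Z (i * d + l) (i * d + k))"
    by (simp add: mtrace_def sum_prod_index)
  also have "\<dots> = (\<Sum>k<d. \<Sum>l<d. \<Sum>i<m. B k l * Z (i * d + l) (i * d + k))"
    by (subst sum.swap, rule sum.cong[OF refl], rule sum.swap)
  finally show ?thesis
    by (simp add: mtrace_def mmul_def ptrace1_def block_def sum_distrib_left)
qed

lemma mtrace_ptrace2_orth_proj:
  assumes "orth_proj d B"
  shows "mtrace m (ptrace2 d
      (mmul (m * d) (mmul (m * d) (kron d d (idm m) B) Z) (kron d d (idm m) B))) =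
    mtrace d (mmul d B (ptrace1 m d Z))"
  unfolding mtrace_ptrace2 orth_proj_conjugate(2)[OF orth_proj_kron_idm[OF assms]]
  by (rule mtrace_mmul_kron_idm)

lemma block_mmul_kron_left:
  assumes "k < d"
  shows "block d (mmul (m * d) (kron d d K (idm d)) X) k l = mmul m K (block d X k l)"
proof (intro ext)
  fix i j
  have "block d (mmul (m * d) (kron d d K (idm d)) X) k l i j =
      (\<Sum>x<m. K i x * (\<Sum>y<d. idm d k y * X (x * d + y) (j * d + l)))"
    unfolding block_def mmul_def sum_prod_index sum_distrib_left using assms
    by (intro sum.cong refl) (simp add: kron_def mult_ac)
  then show "block d (mmul (m * d) (kron d d K (idm d)) X) k l i j = mmul m K (block d X k l) i j"
    using assms by (simp add: sum_idm_left mmul_def block_def)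
qed

lemma block_mmul_kron_right:
  assumes "l < d"
  shows "block d (mmul (m * d) X (kron d d K (idm d))) k l = mmul m (block d X k l) K"
proof (intro ext)
  fix i j
  have "block d (mmul (m * d) X (kron d d K (idm d))) k l i j =
      (\<Sum>x<m. (\<Sum>y<d. X (i * d + k) (x * d + y) * idm d y l) * K x j)"
    unfolding block_def mmul_def sum_prod_index sum_distrib_right using assms
    by (intro sum.cong refl) (simp add: kron_def mult_ac)
  then show "block d (mmul (m * d) X (kron d d K (idm d))) k l i j = mmul m (block d X k l) K i j"
    using assms by (simp add: sum_idm_right mmul_def block_def)
qed

definition lift_kraus :: "nat \<Rightarrow> cmat list \<Rightarrow> cmat list" where
  "lift_kraus d Ks = map (\<lambda>K. kron d d K (idm d)) Ks"

lemma block_kapply_lift_kraus: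
  assumes "k < d" "l < d"
  shows "block d (kapply (m * d) (lift_kraus d Ks) X) k l = kapply m Ks (block d X k l)"
proof (induction Ks)
  case Nil
  then show ?case by (simp add: lift_kraus_def kapply_Nil block_def)
next
  case (Cons K Ks)
  let ?M = "mmul (m * d) (mmul (m * d) (kron d d K (idm d)) X) (kron d d (adj K) (idm d))"
  have "block d (kapply (m * d) (lift_kraus d (K # Ks)) X) k l =
      (\<lambda>i j. block d ?M k l i j + block d (kapply (m * d) (lift_kraus d Ks) X) k l i j)"
    by (simp add: lift_kraus_def kapply_Cons adj_kron adj_idm block_def)
  also have "\<dots> = kapply m (K # Ks) (block d X k l)"
    using assms by (simp add: Cons block_mmul_kron_left block_mmul_kron_right kapply_Cons)
  finally show ?case .
qed

lemma ptrace1_instrument2: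
  assumes "instrument2 m m Kf" and "k < d" "l < d"
  shows "ptrace1 m d (kapply (m * d) (lift_kraus d (Kf False)) X) k l +
    ptrace1 m d (kapply (m * d) (lift_kraus d (Kf True)) X) k l = ptrace1 m d X k l"
  using mtrace_kapply_instrument2[OF assms(1)] assms(2,3)
  by (simp add: ptrace1_def block_kapply_lift_kraus)

subsection \<open>Two states at angle \<open>\<theta>\<close>\<close>

lemma vinner_add_left: "vinner d (\<lambda>i. u i + v i) w = vinner d u w + vinner d v w"
  by (simp add: vinner_def sum.distrib distrib_right)

lemma vinner_add_right: "vinner d u (\<lambda>i. v i + w i) = vinner d u v + vinner d u w"
  by (simp add: vinner_def sum.distrib distrib_left)

lemma vinner_scale_left: "vinner d (\<lambda>i. z * u i) v = cnj z * vinner d u v"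
  by (simp add: vinner_def sum_distrib_left mult.assoc)

lemma vinner_scale_right: "vinner d u (\<lambda>i. z * v i) = z * vinner d u v"
  by (simp add: vinner_def sum_distrib_left mult_ac)

lemmas vinner_linear = vinner_add_left vinner_add_right vinner_scale_left vinner_scale_right

lemma vinner_residual:
  assumes "unitvec d u" "unitvec d v"
  defines "z \<equiv> vinner d u v"
  defines "r \<equiv> \<lambda>i. v i + (- z) * u i"
  shows "vinner d u r = 0" and "vinner d r r = 1 - of_real ((cmod z)\<^sup>2)"
proof -
  have self: "vinner d u u = 1" "vinner d v v = 1"
    using assms unitvec_vinner_self by blast+
  have "vinner d v u = cnj z" unfolding z_def by (rule vinner_commute)
  then show "vinner d u r = 0" and "vinner d r r = 1 - of_real ((cmod z)\<^sup>2)"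
    unfolding r_def vinner_linear self z_def[symmetric] complex_norm_square
    by (simp_all add: algebra_simps)
qed

definition cross_form :: "nat \<Rightarrow> cmat \<Rightarrow> cvec \<Rightarrow> cvec \<Rightarrow> real" where
  "cross_form d A u w = Re (\<Sum>i<d. \<Sum>j<d. cnj (u i) * A i j * w j + cnj (w i) * A i j * u j)"

lemma Re_quadform_combination:
  "Re (quadform d A (\<lambda>i. of_real a * u i + of_real b * w i)) =
    a\<^sup>2 * Re (quadform d A u) + b\<^sup>2 * Re (quadform d A w) + a * b * cross_form d A u w"
proof -
  have "cnj (of_real a * u i + of_real b * w i) * A i j * (of_real a * u j + of_real b * w j) =
     of_real (a\<^sup>2) * (cnj (u i) * A i j * u j) + of_real (b\<^sup>2) * (cnj (w i) * A i j * w j)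
     + of_real (a * b) * (cnj (u i) * A i j * w j + cnj (w i) * A i j * u j)" for i j
    by (simp add: algebra_simps power2_eq_square)
  then show ?thesis
    by (simp only: quadform_def cross_form_def sum.distrib sum_distrib_left[symmetric]) simp
qed

definition fail_weight :: "nat \<Rightarrow> cmat \<Rightarrow> cvec \<Rightarrow> real" where
  "fail_weight d A v = Re (mtrace d A) - Re (quadform d A v)"

lemma fail_weight_nonneg: "psd d A \<Longrightarrow> unitvec d v \<Longrightarrow> 0 \<le> fail_weight d A v"
  by (simp add: fail_weight_def quadform_le_mtrace)

locale state_pair =
  fixes d :: nat and \<psi> :: "bool \<Rightarrow> cvec" and \<theta> :: real
  assumes unitvec_\<psi>: "unitvec d (\<psi> a)"
    and overlap_sq: "(cmod (vinner d (\<psi> False) (\<psi> True)))\<^sup>2 = (cos \<theta>)\<^sup>2"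
    and \<theta>_pos: "0 < \<theta>" and \<theta>_le: "\<theta> \<le> pi / 2"
begin

lemma sin_\<theta>_pos: "0 < sin \<theta>"
  using \<theta>_pos \<theta>_le by (intro sin_gt_zero) auto

lemma cos_sq_eq: "(cos \<theta>)\<^sup>2 = 1 - (sin \<theta>)\<^sup>2"
  by (simp add: cos_squared_eq)

lemma cmod_overlap: "cmod (vinner d (\<psi> a) (\<psi> (\<not> a))) = cos \<theta>"
proof -
  have "0 \<le> cos \<theta>" using \<theta>_pos \<theta>_le by (intro cos_ge_zero) auto
  then have "cmod (vinner d (\<psi> False) (\<psi> True)) = cos \<theta>"
    using overlap_sq by (simp add: power2_eq_iff_nonneg)
  then show ?thesis
    using vinner_commute[of d "\<psi> True" "\<psi> False"] by (cases a) simp_all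
qed

lemma decompose_other_state:
  obtains g w where "cmod g = 1" "unitvec d w" "vinner d (\<psi> a) w = 0"
    "\<psi> (\<not> a) = (\<lambda>i. g * (of_real (cos \<theta>) * \<psi> a i + of_real (sin \<theta>) * w i))"
proof
  let ?u = "\<psi> a" and ?v = "\<psi> (\<not> a)"
  let ?c = "complex_of_real (cos \<theta>)" and ?s = "complex_of_real (sin \<theta>)"
  define z where "z = vinner d ?u ?v"
  define r where "r = (\<lambda>i. ?v i + (- z) * ?u i)"
  define g where "g = (if z = 0 then 1 else sgn z)"
  define w where "w = (\<lambda>i. cnj g / ?s * r i)"
  show "cmod g = 1" by (simp add: g_def norm_sgn)
  then have phase: "g * cnj g = 1" using complex_norm_square[of g] by simp
  have z_polar: "z = g * ?c"
    using cmod_overlap[of a] by (cases "z = 0") (auto simp: g_def z_def sgn_eq)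
  have sin_nonzero: "?s \<noteq> 0" using sin_\<theta>_pos by simp
  have residual: "vinner d ?u r = 0" "vinner d r r = of_real ((sin \<theta>)\<^sup>2)"
    using vinner_residual[of d ?u ?v, OF unitvec_\<psi> unitvec_\<psi>]
    by (simp_all add: r_def z_def cmod_overlap cos_sq_eq)
  show "?v = (\<lambda>i. g * (?c * ?u i + ?s * w i))"
  proof
    fix i
    have "g * (?c * ?u i + ?s * w i) = z * ?u i + g * cnj g * r i"
      using sin_nonzero by (simp add: w_def z_polar algebra_simps)
    then show "?v i = g * (?c * ?u i + ?s * w i)" by (simp add: phase r_def)
  qed
  show "vinner d ?u w = 0"
    unfolding w_def vinner_linear residual by simp
  have "vinner d w w = g * cnj g * (?s\<^sup>2 / ?s\<^sup>2)"
    unfolding w_def vinner_linear residual by (simp add: power2_eq_square)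
  then have "vinner d w w = 1" using phase sin_nonzero by simp
  moreover have "w i = 0" if "d \<le> i" for i
    using that unitvec_\<psi> by (simp add: w_def r_def unitvec_def)
  ultimately show "unitvec d w" by (simp add: unitvec_iff)
qed

lemma other_state_weight_bounds:
  fixes a :: bool
  assumes "psd d A" and t_pos: "0 < t"
  defines "slack \<equiv> t * Re (quadform d A (\<psi> a)) + fail_weight d A (\<psi> a) / (4 * t)"
  shows "Re (quadform d A (\<psi> (\<not> a))) \<le>
      (cos \<theta>)\<^sup>2 * Re (quadform d A (\<psi> a)) + (sin \<theta>)\<^sup>2 * fail_weight d A (\<psi> a) + slack"
    and "(cos \<theta>)\<^sup>2 * Re (quadform d A (\<psi> a)) - slack \<le> Re (quadform d A (\<psi> (\<not> a)))"
proof -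
  obtain g w where phase: "cmod g = 1" and companion: "unitvec d w" "vinner d (\<psi> a) w = 0"
    and other: "\<psi> (\<not> a) = (\<lambda>i. g * (of_real (cos \<theta>) * \<psi> a i + of_real (sin \<theta>) * w i))"
    by (rule decompose_other_state)
  define p where "p = Re (quadform d A (\<psi> a))"
  define r where "r = Re (quadform d A w)"
  define x where "x = cross_form d A (\<psi> a) w"
  define y where "y = cos \<theta> * sin \<theta>"
  have other_weight: "Re (quadform d A (\<psi> (\<not> a))) = (cos \<theta>)\<^sup>2 * p + (sin \<theta>)\<^sup>2 * r + y * x"
    unfolding other quadform_scale phase
    by (simp add: Re_quadform_combination p_def r_def x_def y_def)
  have nonneg: "0 \<le> \<alpha>\<^sup>2 * p + \<beta>\<^sup>2 * r + \<alpha> * \<beta> * x" for \<alpha> \<beta>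
    using \<open>psd d A\<close> unfolding p_def r_def x_def Re_quadform_combination[symmetric] psd_def by blast
  have r_bounds: "0 \<le> r" "r \<le> fail_weight d A (\<psi> a)"
    using \<open>psd d A\<close> quadform_orthonormal_pair_le_mtrace[OF \<open>psd d A\<close> unitvec_\<psi> companion]
    by (simp_all add: psd_def r_def fail_weight_def)
  have "y\<^sup>2 \<le> 1 / 4"
    using mult_const_minus_self_real_le[of "(sin \<theta>)\<^sup>2" 1]
    by (simp add: y_def power_mult_distrib cos_sq_eq mult.commute)
  then have "y\<^sup>2 * r \<le> 1 / 4 * fail_weight d A (\<psi> a)"
    using r_bounds by (intro mult_mono) auto
  then have "t * (y * x) \<le> t * slack" "t * (- (y * x)) \<le> t * slack"
    using nonneg[of t "- y"] nonneg[of t y] t_pos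
    by (simp_all add: slack_def p_def[symmetric] distrib_left power2_eq_square mult_ac)
  then have "y * x \<le> slack" "- (y * x) \<le> slack"
    using t_pos by (simp_all only: mult_le_cancel_left_pos)
  moreover have "0 \<le> (sin \<theta>)\<^sup>2 * r" "(sin \<theta>)\<^sup>2 * r \<le> (sin \<theta>)\<^sup>2 * fail_weight d A (\<psi> a)"
    using r_bounds by (auto intro: mult_left_mono)
  ultimately show "Re (quadform d A (\<psi> (\<not> a))) \<le>
      (cos \<theta>)\<^sup>2 * Re (quadform d A (\<psi> a)) + (sin \<theta>)\<^sup>2 * fail_weight d A (\<psi> a) + slack"
    and "(cos \<theta>)\<^sup>2 * Re (quadform d A (\<psi> a)) - slack \<le> Re (quadform d A (\<psi> (\<not> a)))"
    unfolding other_weight p_def by linarith+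
qed

lemma ensemble_weight_le:
  assumes psd_\<sigma>: "\<And>b a. psd d (\<sigma> b a)"
    and ensemble: "\<And>b k l. k < d \<Longrightarrow> l < d \<Longrightarrow> \<sigma> b a k l + \<sigma> b (\<not> a) k l = \<tau> k l"
    and t_pos: "0 < t"
  defines "T \<equiv> \<lambda>b a. Re (mtrace d (\<sigma> b a))"
    and "err \<equiv> \<Sum>b\<in>UNIV. \<Sum>a\<in>UNIV. fail_weight d (\<sigma> b a) (\<psi> a)"
  shows "(sin \<theta>)\<^sup>2 * (T b a + T (\<not> b) (\<not> a) - Re (mtrace d \<tau>)) \<le>
    t * (T b a + T (\<not> b) a) + err / (4 * t) + err"
proof -
  define e where "e b a = fail_weight d (\<sigma> b a) (\<psi> a)" for b a
  define q where "q b = Re (quadform d (\<sigma> b a) (\<psi> (\<not> a)))" for b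
  have e_nonneg: "0 \<le> e b a" for b a
    unfolding e_def by (intro fail_weight_nonneg psd_\<sigma> unitvec_\<psi>)
  have err_eq: "err = e b a + e (\<not> b) a + e b (\<not> a) + e (\<not> b) (\<not> a)"
    by (cases a; cases b) (simp_all add: err_def e_def UNIV_bool)
  have pass: "Re (quadform d (\<sigma> b a) (\<psi> a)) = T b a - e b a" for b a
    by (simp add: T_def e_def fail_weight_def)
  have trace_sum: "T b a + T b (\<not> a) = Re (mtrace d \<tau>)" for b
    using mtrace_sum_cong[OF ensemble] by (simp add: T_def flip: plus_complex.sel)
  have same_weight: "q b + (T b (\<not> a) - e b (\<not> a)) = Re (quadform d \<tau> (\<psi> (\<not> a)))" for b
    using quadform_sum_cong[OF ensemble] by (simp add: q_def flip: pass plus_complex.sel)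
  have upper: "q b \<le> (cos \<theta>)\<^sup>2 * (T b a - e b a) + (sin \<theta>)\<^sup>2 * e b a
      + (t * (T b a - e b a) + e b a / (4 * t))"
    using other_state_weight_bounds(1)[OF psd_\<sigma> t_pos, of b a a] by (simp add: q_def pass e_def)
  have lower: "(cos \<theta>)\<^sup>2 * (T (\<not> b) a - e (\<not> b) a)
      - (t * (T (\<not> b) a - e (\<not> b) a) + e (\<not> b) a / (4 * t)) \<le> q (\<not> b)"
    using other_state_weight_bounds(2)[OF psd_\<sigma> t_pos, of "\<not> b" a a] by (simp add: q_def pass e_def)
  have "(sin \<theta>)\<^sup>2 * (T b a + T (\<not> b) (\<not> a) - Re (mtrace d \<tau>)) \<le>
      t * (T b a + T (\<not> b) a) - t * (e b a + e (\<not> b) a) + (e b a / (4 * t) + e (\<not> b) a / (4 * t))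
      + 2 * ((sin \<theta>)\<^sup>2 * e b a) - e b a + e (\<not> b) (\<not> a) - e b (\<not> a)
      + e (\<not> b) a - (sin \<theta>)\<^sup>2 * e (\<not> b) a"
    using upper lower trace_sum[of b] same_weight[of b] same_weight[of "\<not> b"]
    unfolding cos_sq_eq trace_sum[of "\<not> b", symmetric] by (simp add: algebra_simps)
  moreover have "e b a / (4 * t) + e (\<not> b) a / (4 * t) \<le> err / (4 * t)"
    unfolding add_divide_distrib[symmetric] err_eq using t_pos e_nonneg
    by (intro divide_right_mono) (simp_all add: add.assoc)
  moreover have "(sin \<theta>)\<^sup>2 * e b a \<le> e b a" "0 \<le> (sin \<theta>)\<^sup>2 * e (\<not> b) a"
    "0 \<le> t * (e b a + e (\<not> b) a)"
    using e_nonneg t_pos by (auto intro!: mult_left_le_one_le simp: abs_square_le_1)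
  ultimately show ?thesis
    using err_eq e_nonneg[of b "\<not> a"] by linarith
qed

text \<open>In the previous bound, \<open>t\<close> is multiplied by at most the trace of \<open>\<tau>\<close> only if the trace of \<open>\<sigma> b a\<close>
  does not exceed that of \<open>\<sigma> (\<not> b) (\<not> a)\<close>; otherwise the two have to be exchanged.\<close>
lemma cheating_weight_le:
  assumes psd_\<sigma>: "\<And>b a. psd d (\<sigma> b a)"
    and ensemble: "\<And>b k l. k < d \<Longrightarrow> l < d \<Longrightarrow> \<sigma> b False k l + \<sigma> b True k l = \<tau> k l"
    and t_pos: "0 < t"
  defines "T \<equiv> \<lambda>b a. Re (mtrace d (\<sigma> b a))"
    and "err \<equiv> \<Sum>b\<in>UNIV. \<Sum>a\<in>UNIV. fail_weight d (\<sigma> b a) (\<psi> a)"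
  shows "(sin \<theta>)\<^sup>2 * (T b a + T (\<not> b) (\<not> a) - Re (mtrace d \<tau>)) \<le>
    t * Re (mtrace d \<tau>) + err / (4 * t) + err"
proof -
  have ensemble': "\<sigma> b a k l + \<sigma> b (\<not> a) k l = \<tau> k l" if "k < d" "l < d" for a b k l
    using ensemble[OF that, of b] by (cases a) (simp_all add: add.commute)
  have trace_sum: "T b a + T b (\<not> a) = Re (mtrace d \<tau>)" for b a
    using mtrace_sum_cong[OF ensemble'] by (simp add: T_def flip: plus_complex.sel)
  have row_bound: "(sin \<theta>)\<^sup>2 * (T b a + T (\<not> b) (\<not> a) - Re (mtrace d \<tau>)) \<le>
      t * (T b a + T (\<not> b) a) + err / (4 * t) + err" for b a
    unfolding T_def err_def by (rule ensemble_weight_le[where \<sigma> = \<sigma>, OF psd_\<sigma> ensemble' t_pos])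
  show ?thesis
  proof (cases "T b a \<le> T (\<not> b) (\<not> a)")
    case True
    then have "t * (T b a + T (\<not> b) a) \<le> t * Re (mtrace d \<tau>)"
      using t_pos trace_sum[of "\<not> b" a] by (intro mult_left_mono) auto
    then show ?thesis using row_bound[of b a] by linarith
  next
    case False
    then have "t * (T (\<not> b) (\<not> a) + T b (\<not> a)) \<le> t * Re (mtrace d \<tau>)"
      using t_pos trace_sum[of b a] by (intro mult_left_mono) auto
    then show ?thesis using row_bound[of "\<not> b" "\<not> a"] by (simp add: add.commute)
  qed
qed

lemma helstrom_bound:
  assumes "psd d A" and dominated: "\<And>x. Re (quadform d A x) \<le> \<tau> * Re (vinner d x x)"
  shows "Re (quadform d A (\<psi> a)) - Re (quadform d A (\<psi> (\<not> a))) \<le> sin \<theta> * \<tau>"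
proof -
  let ?c = "cos \<theta>" and ?s = "sin \<theta>" and ?u = "\<psi> a"
  obtain g w where phase: "cmod g = 1" and companion: "unitvec d w" "vinner d ?u w = 0"
    and other: "\<psi> (\<not> a) = (\<lambda>i. g * (of_real ?c * ?u i + of_real ?s * w i))"
    by (rule decompose_other_state)
  define p where "p = Re (quadform d A ?u)"
  define r where "r = Re (quadform d A w)"
  define x where "x = cross_form d A ?u w"
  \<comment> \<open>On the span of \<open>\<psi> a\<close> and \<open>w\<close>, the difference of the projectors on \<open>\<psi> a\<close> and \<open>\<psi> (\<not> a)\<close> is
    \<open>sin \<theta>\<close> times a reflection, whose unnormalised eigenvectors are \<open>e\<close> and \<open>e'\<close>.\<close>
  define e where "e = (\<lambda>i. of_real (1 + ?s) * ?u i + of_real (- ?c) * w i)"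
  define e' where "e' = (\<lambda>i. of_real ?c * ?u i + of_real (1 + ?s) * w i)"
  have "vinner d w ?u = 0" using companion vinner_commute[of d w ?u] by simp
  then have norm_e: "vinner d e e = of_real ((1 + ?s)\<^sup>2 + ?c\<^sup>2)"
    using companion unitvec_vinner_self[OF unitvec_\<psi>, of a] unitvec_vinner_self[OF companion(1)]
    unfolding e_def vinner_linear by (simp add: power2_eq_square)
  have weight_e: "Re (quadform d A e) = (1 + ?s)\<^sup>2 * p + ?c\<^sup>2 * r - (1 + ?s) * ?c * x"
    unfolding e_def Re_quadform_combination by (simp add: p_def r_def x_def)
  have weight_e': "Re (quadform d A e') = ?c\<^sup>2 * p + (1 + ?s)\<^sup>2 * r + ?c * (1 + ?s) * x"
    unfolding e'_def Re_quadform_combination by (simp add: p_def r_def x_def)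
  have other_weight: "Re (quadform d A (\<psi> (\<not> a))) = ?c\<^sup>2 * p + ?s\<^sup>2 * r + ?c * ?s * x"
    unfolding other quadform_scale phase by (simp add: Re_quadform_combination p_def r_def x_def)
  have "2 * (1 + ?s) * (p - Re (quadform d A (\<psi> (\<not> a)))) =
      ?s * (Re (quadform d A e) - Re (quadform d A e'))"
    unfolding weight_e weight_e' other_weight cos_sq_eq
    by (simp add: algebra_simps power2_eq_square)
  also have "\<dots> \<le> ?s * (\<tau> * Re (vinner d e e))"
    using \<open>psd d A\<close> dominated[of e] sin_\<theta>_pos
    by (intro mult_left_mono) (simp_all add: psd_def diff_le_eq add_increasing2)
  also have "\<dots> = 2 * (1 + ?s) * (?s * \<tau>)"
    unfolding norm_e cos_sq_eq by (simp add: algebra_simps power2_eq_square)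
  finally show ?thesis
    using sin_\<theta>_pos by (simp add: p_def mult_le_cancel_left_pos)
qed

end

subsection \<open>Random paths\<close>

lemma finite_lists_length: "finite {t :: 'r::finite list. length t = n}"
  using finite_lists_length_eq[of "UNIV :: 'r set" n] by simp

lemma sum_lists_length_Suc:
  fixes f :: "'r::finite list \<Rightarrow> 'a::comm_monoid_add"
  shows "(\<Sum>t | length t = Suc n. f t) = (\<Sum>t | length t = n. \<Sum>r\<in>UNIV. f (t @ [r]))"
proof -
  have "(\<Sum>t | length t = n. \<Sum>r\<in>UNIV. f (t @ [r])) = (\<Sum>(t, r)\<in>{t. length t = n} \<times> UNIV. f (t @ [r]))"
    by (rule sum.cartesian_product)
  also have "\<dots> = (\<Sum>t | length t = Suc n. f t)"
    by (rule sum.reindex_bij_witness[where i = "\<lambda>t. (butlast t, last t)"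
          and j = "\<lambda>(t, r). t @ [r]"])
       (auto simp: length_0_conv[symmetric] simp del: length_0_conv)
  finally show ?thesis ..
qed

lemma sum_Collect_if:
  fixes f :: "'r::finite \<Rightarrow> real"
  shows "(\<Sum>r | P r. f r) = (\<Sum>r\<in>UNIV. f r * (if P r then 1 else 0))"
  by (rule sum.mono_neutral_cong_left) auto

lemma max_0_add_square_le:
  fixes z \<delta> :: real
  shows "(max 0 (z + \<delta>))\<^sup>2 \<le> (max 0 z)\<^sup>2 + \<delta>\<^sup>2 + 2 * max 0 z * \<delta>"
proof (cases "0 \<le> z")
  case True
  have "\<bar>max 0 (z + \<delta>)\<bar> \<le> \<bar>z + \<delta>\<bar>" by simp
  then have "(max 0 (z + \<delta>))\<^sup>2 \<le> (z + \<delta>)\<^sup>2" unfolding abs_le_square_iff .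
  then show ?thesis using True by (simp add: power2_sum)
next
  case False
  then have "\<bar>max 0 (z + \<delta>)\<bar> \<le> \<bar>\<delta>\<bar>" by simp
  then show ?thesis using False unfolding abs_le_square_iff by simp
qed

locale path_process =
  fixes p :: "'r::finite list \<Rightarrow> real"
  assumes p_Nil: "p [] = 1"
    and p_nonneg: "0 \<le> p t"
    and sum_p_snoc: "(\<Sum>r\<in>UNIV. p (t @ [r])) = p t"
begin

definition expect :: "nat \<Rightarrow> ('r list \<Rightarrow> real) \<Rightarrow> real" where
  "expect n X = (\<Sum>t | length t = n. p t * X t)"

lemma expect_0: "expect 0 X = X []"
  by (simp add: expect_def p_Nil)

lemma expect_Suc: "expect (Suc n) X = (\<Sum>t | length t = n. \<Sum>r\<in>UNIV. p (t @ [r]) * X (t @ [r]))"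
  unfolding expect_def by (rule sum_lists_length_Suc)

lemma expect_mono: "(\<And>t. length t = n \<Longrightarrow> X t \<le> Y t) \<Longrightarrow> expect n X \<le> expect n Y"
  unfolding expect_def by (intro sum_mono mult_left_mono p_nonneg) auto

lemma expect_cong: "(\<And>t. length t = n \<Longrightarrow> X t = Y t) \<Longrightarrow> expect n X = expect n Y"
  unfolding expect_def by (intro sum.cong) auto

lemma expect_add: "expect n (\<lambda>t. X t + Y t) = expect n X + expect n Y"
  by (simp add: expect_def distrib_left sum.distrib)

lemma expect_diff: "expect n (\<lambda>t. X t - Y t) = expect n X - expect n Y"
  by (simp add: expect_def right_diff_distrib sum_subtractf)

lemma expect_mult: "expect n (\<lambda>t. a * X t) = a * expect n X"
  by (simp add: expect_def sum_distrib_left mult_ac)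

lemma expect_sum: "expect n (\<lambda>t. \<Sum>x\<in>S. X x t) = (\<Sum>x\<in>S. expect n (X x))"
  unfolding expect_def sum_distrib_left by (rule sum.swap)

lemma expect_le_power:
  assumes "0 \<le> M"
    and "\<And>t. length t < n \<Longrightarrow> (\<Sum>r\<in>UNIV. p (t @ [r]) * X (t @ [r])) \<le> M * (p t * X t)"
  shows "expect n X \<le> M ^ n * X []"
  using assms(2)
proof (induction n)
  case 0
  then show ?case by (simp add: expect_0)
next
  case (Suc n)
  have "expect (Suc n) X \<le> (\<Sum>t | length t = n. M * (p t * X t))"
    unfolding expect_Suc by (intro sum_mono Suc.prems) simp
  also have "\<dots> = M * expect n X"
    by (simp add: expect_def sum_distrib_left)
  also have "\<dots> \<le> M * (M ^ n * X [])"
    using assms(1) Suc.prems by (intro mult_left_mono Suc.IH) auto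
  finally show ?case by simp
qed

lemma expect_eq_power:
  assumes "0 \<le> M"
    and "\<And>t. length t < n \<Longrightarrow> (\<Sum>r\<in>UNIV. p (t @ [r]) * X (t @ [r])) = M * (p t * X t)"
  shows "expect n X = M ^ n * X []"
proof (rule antisym)
  show "expect n X \<le> M ^ n * X []"
    using assms by (intro expect_le_power) simp_all
  have "expect n (\<lambda>t. - X t) \<le> M ^ n * - X []"
    using assms by (intro expect_le_power) (simp_all add: sum_negf)
  then show "M ^ n * X [] \<le> expect n X"
    using expect_mult[of n "- 1" X] by simp
qed

lemma expect_const: "expect n (\<lambda>_. a) = a"
  using expect_eq_power[of 1 n "\<lambda>_. a"] by (simp add: sum_distrib_right[symmetric] sum_p_snoc)

lemma expect_le_linear:
  assumes "\<And>t. (\<Sum>r\<in>UNIV. p (t @ [r]) * X (t @ [r])) \<le> p t * (X t + \<kappa>)"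
  shows "expect n X \<le> X [] + real n * \<kappa>"
proof (induction n)
  case 0
  then show ?case by (simp add: expect_0)
next
  case (Suc n)
  have "expect (Suc n) X \<le> expect n (\<lambda>t. X t + \<kappa>)"
    unfolding expect_Suc unfolding expect_def by (intro sum_mono assms)
  then show ?case using Suc by (simp add: expect_add expect_const algebra_simps)
qed

lemma expect_le_sqrt: "expect n X \<le> sqrt (expect n (\<lambda>t. (X t)\<^sup>2))"
proof -
  have "0 \<le> expect n (\<lambda>t. (X t - expect n X)\<^sup>2)"
    using expect_mono[of n "\<lambda>_. 0"] by (simp add: expect_const)
  also have "\<dots> = expect n (\<lambda>t. (X t)\<^sup>2 - 2 * expect n X * X t + (expect n X)\<^sup>2)"
    by (simp add: power2_diff algebra_simps)
  also have "\<dots> = expect n (\<lambda>t. (X t)\<^sup>2) - (expect n X)\<^sup>2"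
    by (simp add: expect_add expect_diff expect_mult expect_const power2_eq_square)
  finally show ?thesis by (intro real_le_rsqrt) simp
qed

lemma expect_pos_part_le:
  assumes start: "Z [] = 0"
    and increments: "\<And>t r. \<bar>Z (t @ [r]) - Z t\<bar> \<le> K"
    and drift: "\<And>t. (\<Sum>r\<in>UNIV. p (t @ [r]) * (Z (t @ [r]) - Z t)) \<le> 0"
  shows "expect n (\<lambda>t. max 0 (Z t)) \<le> K * sqrt (real n)"
proof -
  have "0 \<le> K" using increments[of "[]"] by (meson abs_ge_zero order_trans)
  have square: "(max 0 (Z (t @ [r])))\<^sup>2 \<le>
      (max 0 (Z t))\<^sup>2 + K\<^sup>2 + 2 * max 0 (Z t) * (Z (t @ [r]) - Z t)" for t r
  proof -
    have "(Z (t @ [r]) - Z t)\<^sup>2 \<le> K\<^sup>2"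
      using increments \<open>0 \<le> K\<close> by (simp add: abs_le_square_iff[symmetric])
    then show ?thesis
      using max_0_add_square_le[of "Z t" "Z (t @ [r]) - Z t"] by simp
  qed
  have "(\<Sum>r\<in>UNIV. p (t @ [r]) * (max 0 (Z (t @ [r])))\<^sup>2) \<le> p t * ((max 0 (Z t))\<^sup>2 + K\<^sup>2)" for t
  proof -
    have "(\<Sum>r\<in>UNIV. p (t @ [r]) * (max 0 (Z (t @ [r])))\<^sup>2) \<le>
        (\<Sum>r\<in>UNIV. p (t @ [r]) * ((max 0 (Z t))\<^sup>2 + K\<^sup>2 + 2 * max 0 (Z t) * (Z (t @ [r]) - Z t)))"
      by (intro sum_mono mult_left_mono square p_nonneg)
    also have "\<dots> = (\<Sum>r\<in>UNIV. p (t @ [r])) * ((max 0 (Z t))\<^sup>2 + K\<^sup>2)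
        + 2 * max 0 (Z t) * (\<Sum>r\<in>UNIV. p (t @ [r]) * (Z (t @ [r]) - Z t))"
      unfolding distrib_left sum.distrib sum_distrib_left sum_distrib_right by (simp add: mult_ac)
    also have "\<dots> \<le> p t * ((max 0 (Z t))\<^sup>2 + K\<^sup>2)"
      using drift[of t] by (simp add: sum_p_snoc mult_nonneg_nonpos)
    finally show ?thesis .
  qed
  from expect_le_linear[of "\<lambda>t. (max 0 (Z t))\<^sup>2", OF this]
  have "sqrt (expect n (\<lambda>t. (max 0 (Z t))\<^sup>2)) \<le> sqrt (real n * K\<^sup>2)"
    using start by simp
  then show ?thesis
    using expect_le_sqrt[of n "\<lambda>t. max 0 (Z t)"] \<open>0 \<le> K\<close> by (simp add: real_sqrt_mult mult.commute)
qed

end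

subsection \<open>Projections of random paths\<close>

definition push :: "('r \<Rightarrow> 's) \<Rightarrow> ('r list \<Rightarrow> real) \<Rightarrow> 's list \<Rightarrow> real" where
  "push f p x = (\<Sum>t | map f t = x. p t)"

lemma push_snoc:
  fixes f :: "'r::finite \<Rightarrow> 's"
  shows "push f p (x @ [y]) = (\<Sum>t | map f t = x. \<Sum>r | f r = y. p (t @ [r]))"
proof -
  have "(\<Sum>t | map f t = x. \<Sum>r | f r = y. p (t @ [r])) =
      (\<Sum>(t, r)\<in>{t. map f t = x} \<times> {r. f r = y}. p (t @ [r]))"
    by (rule sum.cartesian_product)
  also have "\<dots> = push f p (x @ [y])"
    unfolding push_def
    by (rule sum.reindex_bij_witness[where i = "\<lambda>t. (butlast t, last t)"
          and j = "\<lambda>(t, r). t @ [r]"])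
       (auto dest!: map_eq_append_conv[THEN iffD1])
  finally show ?thesis ..
qed

lemma sum_push:
  fixes f :: "'r::finite \<Rightarrow> 's::finite"
  shows "(\<Sum>x | length x = n. push f p x * X x) = (\<Sum>t | length t = n. p t * X (map f t))"
proof -
  have "(\<Sum>x | length x = n. push f p x * X x) =
      (\<Sum>x | length x = n. \<Sum>t | t \<in> {t. length t = n} \<and> map f t = x. p t * X (map f t))"
    unfolding push_def sum_distrib_right by (intro sum.cong refl) auto
  also have "\<dots> = (\<Sum>t | length t = n. p t * X (map f t))"
    by (rule sum.group) (auto simp: finite_lists_length)
  finally show ?thesis .
qed

lemma (in path_process) path_process_push:
  fixes f :: "'r \<Rightarrow> 's::finite"
  shows "path_process (push f p)"
proof
  show "push f p [] = 1" by (simp add: push_def p_Nil)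
  show "0 \<le> push f p x" for x unfolding push_def by (intro sum_nonneg p_nonneg)
  show "(\<Sum>y\<in>UNIV. push f p (x @ [y])) = push f p x" for x
  proof -
    have fibres: "(\<Sum>y\<in>UNIV. \<Sum>r | f r = y. h r) = (\<Sum>r\<in>UNIV. h r)" for h :: "'r \<Rightarrow> real"
      using sum.group[of UNIV UNIV f h] by simp
    have "(\<Sum>y\<in>UNIV. push f p (x @ [y])) = (\<Sum>t | map f t = x. \<Sum>y\<in>UNIV. \<Sum>r | f r = y. p (t @ [r]))"
      unfolding push_snoc by (rule sum.swap)
    also have "\<dots> = (\<Sum>t | map f t = x. p t)"
      unfolding fibres sum_p_snoc ..
    finally show ?thesis by (simp add: push_def)
  qed
qed

subsection \<open>Entropy\<close>

lemma finite_bitstrings: "finite (bitstrings n)"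
  unfolding bitstrings_def by (rule finite_lists_length)

lemma card_bitstrings: "card (bitstrings n) = 2 ^ n"
  using card_lists_length_eq[of "UNIV :: bool set" n] by (simp add: bitstrings_def)

lemma ent_term_nonneg: "0 \<le> p \<Longrightarrow> p \<le> 1 \<Longrightarrow> 0 \<le> ent_term p"
  by (auto simp: ent_term_def mult_nonneg_nonpos)

lemma ent_term_mult:
  assumes "0 \<le> q" "0 \<le> x"
  shows "ent_term (q * x) = q * ent_term x + x * ent_term q"
  using assms by (auto simp: ent_term_def log_mult_pos algebra_simps)

lemma ent_term_add_ge:
  assumes "0 \<le> u" "0 \<le> v" "u + v \<le> 1"
  shows "ent_term u - v / ln 2 \<le> ent_term (u + v)"
proof (cases "u = 0")
  case True
  have "0 \<le> v / ln 2" using assms by simp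
  moreover have "ent_term u = 0" "0 \<le> ent_term (u + v)"
    using True ent_term_nonneg[of v] assms by (simp_all add: ent_term_def)
  ultimately show ?thesis by linarith
next
  case False
  then have u_pos: "0 < u" using assms by simp
  have "ln (u + v) = ln (u * (1 + v / u))" using u_pos by (simp add: distrib_left)
  also have "\<dots> = ln u + ln (1 + v / u)"
    using u_pos assms by (intro ln_mult_pos) (simp_all add: add_pos_nonneg)
  also have "ln (1 + v / u) \<le> v / u" using u_pos assms by (intro ln_add_one_self_le_self) simp
  finally have "u * ln (u + v) \<le> u * (ln u + v / u)" using u_pos by (intro mult_left_mono) auto
  moreover have "v * ln (u + v) \<le> 0" using assms u_pos by (intro mult_nonneg_nonpos) auto
  ultimately have "- u * ln u - v \<le> - (u + v) * ln (u + v)" using u_pos by (simp add: algebra_simps)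
  then have "(- u * ln u - v) / ln 2 \<le> - (u + v) * ln (u + v) / ln 2"
    by (intro divide_right_mono) auto
  then show ?thesis using u_pos assms by (simp add: ent_term_def log_def diff_divide_distrib)
qed

lemma ent_term_ge_mult_log:
  assumes "0 \<le> u" "u \<le> k"
  shows "u * (- log 2 k) \<le> ent_term u"
proof (cases "u = 0")
  case False
  then have "log 2 u \<le> log 2 k" using assms by simp
  then show ?thesis using assms False by (simp add: ent_term_def mult_left_mono)
qed (simp add: ent_term_def)

lemma shannon_ge_of_bounded_part:
  assumes "finite X" and split: "\<And>x. x \<in> X \<Longrightarrow> Y x = U x + V x"
    and U_bounds: "\<And>x. x \<in> X \<Longrightarrow> 0 \<le> U x" "\<And>x. x \<in> X \<Longrightarrow> U x \<le> k"
    and V_nonneg: "\<And>x. x \<in> X \<Longrightarrow> 0 \<le> V x" and total: "(\<Sum>x\<in>X. Y x) = 1"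
  shows "(1 - (\<Sum>x\<in>X. V x)) * (- log 2 k) - (\<Sum>x\<in>X. V x) / ln 2 \<le> shannon Y X"
proof -
  have "(\<Sum>x\<in>X. U x) = 1 - (\<Sum>x\<in>X. V x)" using total split by (simp add: sum.distrib)
  then have "(1 - (\<Sum>x\<in>X. V x)) * (- log 2 k) - (\<Sum>x\<in>X. V x) / ln 2 =
      (\<Sum>x\<in>X. U x * (- log 2 k) - V x / ln 2)"
    by (simp add: sum_subtractf sum_negf sum_distrib_right[symmetric] sum_divide_distrib[symmetric])
  also have "\<dots> \<le> (\<Sum>x\<in>X. ent_term (Y x))"
  proof (rule sum_mono)
    fix x assume x_in: "x \<in> X"
    have "Y x \<le> (\<Sum>x\<in>X. Y x)"
      using \<open>finite X\<close> U_bounds V_nonneg split x_in by (intro member_le_sum) auto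
    then show "U x * (- log 2 k) - V x / ln 2 \<le> ent_term (Y x)"
      using ent_term_add_ge[of "U x" "V x"] ent_term_ge_mult_log[of "U x" k]
        U_bounds V_nonneg split x_in total
      by fastforce
  qed
  finally show ?thesis by (simp add: shannon_def)
qed

lemma bin_ent_antimono:
  assumes "1/2 \<le> x" "x \<le> y" "y \<le> 1"
  shows "bin_ent y \<le> bin_ent x"
proof (cases "y = 1")
  case True
  then have "bin_ent y = 0" by (simp add: bin_ent_def ent_term_def)
  then show ?thesis
    using assms by (auto simp: bin_ent_def intro!: add_nonneg_nonneg ent_term_nonneg)
next
  case False
  define H where "H z = - z * ln z - (1 - z) * ln (1 - z)" for z :: real
  have bin_ent_eq: "bin_ent z = H z / ln 2" if "0 < z" "z < 1" for z
    using that by (simp add: bin_ent_def ent_term_def H_def log_def) (simp add: field_simps)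
  have "H y \<le> H x"
  proof (rule DERIV_nonpos_imp_nonincreasing[OF assms(2)])
    fix z assume "x \<le> z" "z \<le> y"
    then have z_bounds: "0 < z" "z < 1" "1/2 \<le> z" using assms False by auto
    have "(H has_real_derivative (ln (1 - z) - ln z)) (at z)"
      unfolding H_def[abs_def] using z_bounds by (auto intro!: derivative_eq_intros)
    moreover have "ln (1 - z) - ln z \<le> 0" using z_bounds by simp
    ultimately show "\<exists>D. (H has_real_derivative D) (at z) \<and> D \<le> 0" by blast
  qed
  then show ?thesis using assms False by (simp add: bin_ent_eq divide_right_mono)
qed

lemma bin_ent_le:
  assumes "x \<le> \<kappa>" "1 - x \<le> \<kappa>" "\<kappa> \<le> 1"
  shows "bin_ent \<kappa> \<le> bin_ent x"
proof (cases "1/2 \<le> x")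
  case True
  then show ?thesis using assms by (intro bin_ent_antimono)
next
  case False
  then have "bin_ent \<kappa> \<le> bin_ent (1 - x)" using assms by (intro bin_ent_antimono) auto
  then show ?thesis by (simp add: bin_ent_def)
qed

lemma ent_term_split_ge:
  assumes a_bounds: "0 \<le> a" "a \<le> \<kappa> * (a + b)" and b_bounds: "0 \<le> b" "b \<le> \<kappa> * (a + b)" and "\<kappa> \<le> 1"
  shows "ent_term (a + b) + (a + b) * bin_ent \<kappa> \<le> ent_term a + ent_term b"
proof (cases "a + b = 0")
  case True
  then have "a = 0" "b = 0" using a_bounds b_bounds by auto
  then show ?thesis by (simp add: ent_term_def)
next
  case False
  define q where "q = a + b"
  define x where "x = a / q"
  have q_pos: "0 < q" using False a_bounds b_bounds by (simp add: q_def)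
  have a_eq: "a = q * x" and b_eq: "b = q * (1 - x)"
    using q_pos by (simp_all add: x_def q_def field_simps)
  have "x \<le> \<kappa>" "1 - x \<le> \<kappa>"
    using a_bounds(2) b_bounds(2) q_pos
    unfolding q_def[symmetric] by (simp_all add: a_eq b_eq mult.commute[of q])
  then have "q * bin_ent \<kappa> \<le> q * bin_ent x"
    using q_pos \<open>\<kappa> \<le> 1\<close> by (simp add: bin_ent_le)
  moreover have "0 \<le> x" "x \<le> 1" using a_bounds b_bounds q_pos by (simp_all add: x_def q_def)
  then have "ent_term a + ent_term b = q * bin_ent x + ent_term q"
    using q_pos ent_term_mult[of q x] ent_term_mult[of q "1 - x"]
    unfolding a_eq b_eq by (simp add: bin_ent_def algebra_simps)
  ultimately show ?thesis by (simp add: q_def)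
qed

subsection \<open>Guessing bits from a tested process\<close>

definition agreements :: "bool list \<Rightarrow> bool list \<Rightarrow> real" where
  "agreements c x = (\<Sum>i<length x. if x ! i = c ! i then 1 else 0)"

lemma agreements_snoc:
  "agreements c (x @ [y]) = agreements c x + (if y = c ! length x then 1 else 0)"
proof -
  have "(\<Sum>i<length x. if (x @ [y]) ! i = c ! i then 1 else 0) = agreements c x"
    unfolding agreements_def by (intro sum.cong refl) (simp add: nth_append)
  then show ?thesis by (simp add: agreements_def)
qed

lemma sum_prob_agreements:
  "(\<Sum>i<n. \<Sum>t | length t = n. p t * (if P t \<and> map out t ! i = c ! i then 1 else 0)) =
    (\<Sum>t | length t = n. p t * (if P t then agreements c (map out t) else 0))"
proof -
  have "(\<Sum>i<n. \<Sum>t | length t = n. p t * (if P t \<and> map out t ! i = c ! i then 1 else 0)) =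
      (\<Sum>t | length t = n. \<Sum>i<n. p t * (if P t \<and> map out t ! i = c ! i then 1 else 0))"
    by (rule sum.swap)
  also have "\<dots> = (\<Sum>t | length t = n. p t * (if P t then agreements c (map out t) else 0))"
    by (intro sum.cong refl) (auto simp: agreements_def sum_distrib_left intro!: sum.cong)
  finally show ?thesis .
qed

lemma snoc_eq_take_Suc_iff:
  assumes "length x < length c"
  shows "x @ [y] = take (Suc (length x)) c \<longleftrightarrow> x = take (length x) c \<and> y = c ! length x"
  using assms by (auto simp: take_Suc_conv_app_nth)

lemma bernoulli_mgf_le:
  fixes x l :: real
  assumes "0 \<le> x" "x \<le> 1" "0 \<le> l"
  shows "1 - x + x * exp (- l) \<le> exp (l\<^sup>2 / 8 - l * x)"
proof -
  have pos: "0 < 1 + (1 - x) * (exp l - 1)"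
    using assms by (intro add_pos_nonneg mult_nonneg_nonneg) auto
  have "ln (1 + (1 - x) * (exp l - 1)) \<le> l\<^sup>2 / 8 + l * (1 - x)"
    using Hoeffdings_lemma_aux[of l "1 - x"] assms by simp
  then have "1 + (1 - x) * (exp l - 1) \<le> exp (l\<^sup>2 / 8 + l * (1 - x))"
    using pos by (metis exp_le_cancel_iff exp_ln)
  then have "exp (- l) * (1 + (1 - x) * (exp l - 1)) \<le> exp (- l) * exp (l\<^sup>2 / 8 + l * (1 - x))"
    by (intro mult_left_mono) auto
  also have "\<dots> = exp (l\<^sup>2 / 8 - l * x)"
    by (simp add: exp_add[symmetric] algebra_simps)
  finally show ?thesis by (simp add: algebra_simps exp_add[symmetric])
qed

lemma one_le_ln:
  assumes "3 \<le> n"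
  shows "1 \<le> ln (real n)"
proof -
  have "exp 1 \<le> real n" using exp_le assms by linarith
  then show ?thesis using assms by (subst ln_ge_iff) auto
qed

locale tested_process = path_process p for p :: "'r::finite list \<Rightarrow> real" +
  fixes out pass :: "'r \<Rightarrow> bool" and \<alpha> \<beta> \<epsilon> :: real
  assumes out_step: "(\<Sum>r | out r = y. p (t @ [r])) \<le>
      (1/2 + \<beta>) * p t + \<alpha> * (\<Sum>r | \<not> pass r. p (t @ [r]))"
    and coeffs_nonneg: "0 \<le> \<alpha>" "0 \<le> \<beta>" "0 \<le> \<epsilon>"
begin

definition failures :: "'r list \<Rightarrow> real" where
  "failures t = real (length (filter (\<lambda>r. \<not> pass r) t))"

definition accepted :: "'r list \<Rightarrow> bool" where
  "accepted t \<longleftrightarrow> failures t \<le> real (length t) * \<epsilon>"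

definition guess_rate :: real where
  "guess_rate = 1/2 + \<beta> + \<alpha> * \<epsilon>"

lemma failures_snoc: "failures (t @ [r]) = failures t + (if pass r then 0 else 1)"
  by (simp add: failures_def)

lemma guess_rate_ge_half: "1/2 \<le> guess_rate"
  using coeffs_nonneg by (simp add: guess_rate_def)

lemma expect_accepted_agreements_le:
  "expect n (\<lambda>t. if accepted t then agreements c (map out t) else 0) \<le>
    real n * guess_rate + (1/2 + \<alpha> + \<beta>) * sqrt (real n)"
proof -
  define Z where
    "Z t = agreements c (map out t) - \<alpha> * failures t - (1/2 + \<beta>) * real (length t)" for t
  have step: "Z (t @ [r]) - Z t = (if out r = c ! length t then 1 else 0)
      - \<alpha> * (if \<not> pass r then 1 else 0) - (1/2 + \<beta>)" for t r
    by (simp add: Z_def agreements_snoc failures_snoc algebra_simps)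
  have "(\<Sum>r\<in>UNIV. p (t @ [r]) * (Z (t @ [r]) - Z t)) \<le> 0" for t
  proof -
    have "(\<Sum>r\<in>UNIV. p (t @ [r]) * (Z (t @ [r]) - Z t)) = (\<Sum>r | out r = c ! length t. p (t @ [r]))
        - \<alpha> * (\<Sum>r | \<not> pass r. p (t @ [r])) - (1/2 + \<beta>) * (\<Sum>r\<in>UNIV. p (t @ [r]))"
      unfolding step sum_Collect_if sum_distrib_left sum_subtractf[symmetric]
      by (intro sum.cong refl) (simp add: algebra_simps)
    then show ?thesis using out_step[where t = t and y = "c ! length t"] by (simp add: sum_p_snoc)
  qed
  then have "expect n (\<lambda>t. max 0 (Z t)) \<le> (1/2 + \<alpha> + \<beta>) * sqrt (real n)"
    using coeffs_nonneg
    by (intro expect_pos_part_le) (auto simp: step Z_def[of "[]"] agreements_def failures_def)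
  moreover have "expect n (\<lambda>t. if accepted t then agreements c (map out t) else 0) \<le>
      expect n (\<lambda>t. max 0 (Z t) + real n * guess_rate)"
  proof (rule expect_mono)
    fix t :: "'r list" assume len: "length t = n"
    show "(if accepted t then agreements c (map out t) else 0) \<le> max 0 (Z t) + real n * guess_rate"
    proof (cases "accepted t")
      case True
      then have "\<alpha> * failures t \<le> \<alpha> * (real n * \<epsilon>)"
        using coeffs_nonneg len by (intro mult_left_mono) (simp_all add: accepted_def)
      moreover have "Z t \<le> max 0 (Z t)" by simp
      ultimately show ?thesis
        using True len by (simp add: Z_def guess_rate_def algebra_simps)
    next
      case False
      then show ?thesis using guess_rate_ge_half by simp
    qed
  qed
  ultimately show ?thesis by (simp add: expect_add expect_const)
qed

definition fail_prob :: "'r list \<Rightarrow> real" where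
  "fail_prob t = (\<Sum>r | \<not> pass r. p (t @ [r])) / p t"

definition compensator :: "'r list \<Rightarrow> real" where
  "compensator t = (\<Sum>i<length t. fail_prob (take i t))"

lemma compensator_snoc: "compensator (t @ [r]) = compensator t + fail_prob t"
  by (simp add: compensator_def)

lemma sum_fail_le: "(\<Sum>r | \<not> pass r. p (t @ [r])) \<le> p t"
  using sum_mono2[of UNIV "{r. \<not> pass r}" "\<lambda>r. p (t @ [r])"] by (simp add: sum_p_snoc p_nonneg)

lemma fail_prob_mult: "fail_prob t * p t = (\<Sum>r | \<not> pass r. p (t @ [r]))"
proof (cases "p t = 0")
  case True
  have "0 \<le> (\<Sum>r | \<not> pass r. p (t @ [r]))" by (intro sum_nonneg p_nonneg)
  then show ?thesis using True sum_fail_le[of t] by simp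
qed (simp add: fail_prob_def)

lemma fail_prob_bounds: "0 \<le> fail_prob t" "fail_prob t \<le> 1"
proof -
  show "0 \<le> fail_prob t" unfolding fail_prob_def by (intro divide_nonneg_nonneg sum_nonneg p_nonneg)
  show "fail_prob t \<le> 1" using sum_fail_le[of t] p_nonneg[of t]
    by (cases "p t = 0") (simp_all add: fail_prob_def divide_le_eq)
qed

lemma tilted_out_step:
  "exp (- \<alpha> / guess_rate * (fail_prob t - \<epsilon>)) * (\<Sum>r | out r = y. p (t @ [r])) \<le> guess_rate * p t"
proof -
  let ?G = guess_rate and ?x = "\<alpha> / guess_rate * (fail_prob t - \<epsilon>)"
  have G_pos: "0 < ?G" using guess_rate_ge_half by simp
  have "(\<Sum>r | out r = y. p (t @ [r])) \<le> (1/2 + \<beta> + \<alpha> * fail_prob t) * p t"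
    using out_step[where t = t and y = y] by (simp add: fail_prob_mult[symmetric] algebra_simps)
  also have "1/2 + \<beta> + \<alpha> * fail_prob t = ?G * (1 + ?x)"
    using G_pos by (simp add: distrib_left) (simp add: guess_rate_def algebra_simps)
  also have "?G * (1 + ?x) * p t \<le> ?G * exp ?x * p t"
    using G_pos by (intro mult_right_mono mult_left_mono exp_ge_add_one_self p_nonneg) simp
  finally have "exp (- ?x) * (\<Sum>r | out r = y. p (t @ [r])) \<le> exp (- ?x) * (?G * exp ?x * p t)"
    by (intro mult_left_mono) simp_all
  also have "\<dots> = exp (- ?x) * exp ?x * (?G * p t)" by (simp only: mult_ac)
  finally show ?thesis by (simp add: mult_exp_exp)
qed

lemma prob_output_low_compensator_le:
  assumes "length c = n"
  shows "expect n (\<lambda>t. if map out t = c \<and> compensator t \<le> real n * \<epsilon> + \<Delta> then 1 else 0) \<le>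
    exp (\<alpha> / guess_rate * \<Delta>) * guess_rate ^ n"
proof -
  define g where "g = \<alpha> / guess_rate"
  define X where "X t = (if map out t = take (length t) c
    then exp (g * (real (length t) * \<epsilon> - compensator t)) else 0)" for t
  have g_nonneg: "0 \<le> g" using guess_rate_ge_half coeffs_nonneg by (simp add: g_def)
  have "(\<Sum>r\<in>UNIV. p (t @ [r]) * X (t @ [r])) \<le> guess_rate * (p t * X t)" if "length t < n" for t
  proof -
    have "X (t @ [r]) = X t * exp (- g * (fail_prob t - \<epsilon>))
        * (if out r = c ! length t then 1 else 0)" for r
      using snoc_eq_take_Suc_iff[of "map out t" c "out r"] that assms
      by (simp add: X_def compensator_snoc exp_add[symmetric] algebra_simps)
    then have "(\<Sum>r\<in>UNIV. p (t @ [r]) * X (t @ [r])) =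
        X t * (exp (- g * (fail_prob t - \<epsilon>)) * (\<Sum>r | out r = c ! length t. p (t @ [r])))"
      unfolding sum_Collect_if sum_distrib_left by (simp add: mult_ac)
    also have "\<dots> \<le> X t * (guess_rate * p t)"
      using tilted_out_step by (intro mult_left_mono) (simp_all add: g_def X_def)
    finally show ?thesis by (simp add: mult_ac)
  qed
  then have "expect n X \<le> guess_rate ^ n"
    using expect_le_power[of guess_rate n X] guess_rate_ge_half by (simp add: X_def compensator_def)
  moreover have "expect n (\<lambda>t. if map out t = c \<and> compensator t \<le> real n * \<epsilon> + \<Delta> then 1 else 0) \<le>
      expect n (\<lambda>t. exp (g * \<Delta>) * X t)"
  proof (rule expect_mono)
    fix t :: "'r list" assume "length t = n"
    moreover have "1 \<le> exp (g * \<Delta>) * exp (g * (real n * \<epsilon> - compensator t))"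
      if "compensator t \<le> real n * \<epsilon> + \<Delta>"
      using that g_nonneg by (simp add: exp_add[symmetric] distrib_left[symmetric])
    ultimately show "(if map out t = c \<and> compensator t \<le> real n * \<epsilon> + \<Delta> then 1 else 0) \<le>
        exp (g * \<Delta>) * X t"
      using assms by (auto simp: X_def)
  qed
  ultimately show ?thesis
    by (simp add: expect_mult g_def order_trans[OF _ mult_left_mono])
qed

lemma tilted_failure_step:
  assumes "0 \<le> l"
  shows "(\<Sum>r\<in>UNIV. p (t @ [r]) * exp (l * (fail_prob t - (if pass r then 0 else 1)))) \<le>
      exp (l\<^sup>2 / 8) * p t"
proof -
  let ?x = "fail_prob t"
  have "(\<Sum>r\<in>UNIV. p (t @ [r]) * exp (l * (?x - (if pass r then 0 else 1)))) =
      exp (l * ?x) * ((\<Sum>r\<in>UNIV. p (t @ [r])) + (exp (- l) - 1) * (\<Sum>r | \<not> pass r. p (t @ [r])))"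
    unfolding sum_Collect_if sum_distrib_left sum.distrib[symmetric]
    by (intro sum.cong refl) (simp add: exp_add[symmetric] algebra_simps)
  also have "\<dots> = exp (l * ?x) * (1 - ?x + ?x * exp (- l)) * p t"
    unfolding sum_p_snoc fail_prob_mult[symmetric] by (simp add: algebra_simps)
  also have "\<dots> \<le> exp (l * ?x) * exp (l\<^sup>2 / 8 - l * ?x) * p t"
    using fail_prob_bounds assms
    by (intro mult_right_mono mult_left_mono bernoulli_mgf_le p_nonneg) auto
  finally show ?thesis by (simp add: exp_add[symmetric])
qed

lemma prob_failures_below_compensator_le:
  assumes "1 \<le> n" "0 \<le> \<Delta>"
  shows "expect n (\<lambda>t. if failures t + \<Delta> < compensator t then 1 else 0) \<le> exp (- 2 * \<Delta>\<^sup>2 / real n)"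
proof -
  define l where "l = 4 * \<Delta> / real n"
  define X where "X t = exp (l * (compensator t - failures t))" for t
  have l_nonneg: "0 \<le> l" using assms by (simp add: l_def)
  have "(\<Sum>r\<in>UNIV. p (t @ [r]) * X (t @ [r])) \<le> exp (l\<^sup>2 / 8) * (p t * X t)" for t
  proof -
    have "X (t @ [r]) = X t * exp (l * (fail_prob t - (if pass r then 0 else 1)))" for r
      by (simp add: X_def compensator_snoc failures_snoc exp_add[symmetric] algebra_simps)
    then have "(\<Sum>r\<in>UNIV. p (t @ [r]) * X (t @ [r])) =
        X t * (\<Sum>r\<in>UNIV. p (t @ [r]) * exp (l * (fail_prob t - (if pass r then 0 else 1))))"
      by (simp add: sum_distrib_left mult_ac)
    also have "\<dots> \<le> X t * (exp (l\<^sup>2 / 8) * p t)"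
      by (intro mult_left_mono tilted_failure_step l_nonneg) (simp add: X_def)
    finally show ?thesis by (simp add: mult_ac)
  qed
  then have "expect n X \<le> exp (l\<^sup>2 / 8) ^ n"
    using expect_le_power[of "exp (l\<^sup>2 / 8)" n X] by (simp add: X_def compensator_def failures_def)
  moreover have "expect n (\<lambda>t. if failures t + \<Delta> < compensator t then 1 else 0) \<le>
      expect n (\<lambda>t. exp (- l * \<Delta>) * X t)"
  proof (rule expect_mono)
    fix t
    have "exp (- l * \<Delta>) * X t = exp (l * (compensator t - failures t - \<Delta>))"
      by (simp add: X_def exp_add[symmetric] algebra_simps)
    then show "(if failures t + \<Delta> < compensator t then 1 else 0) \<le> exp (- l * \<Delta>) * X t"
      using l_nonneg by simp
  qed
  ultimately have "expect n (\<lambda>t. if failures t + \<Delta> < compensator t then 1 else 0) \<le>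
      exp (- l * \<Delta>) * exp (l\<^sup>2 / 8) ^ n"
    by (simp add: expect_mult order_trans[OF _ mult_left_mono])
  also have "\<dots> = exp (- 2 * \<Delta>\<^sup>2 / real n)"
    using assms
    by (simp add: exp_of_nat_mult[symmetric] exp_add[symmetric] l_def field_simps power2_eq_square)
  finally show ?thesis .
qed

definition output_dist :: "nat \<Rightarrow> bool list \<Rightarrow> real" where
  "output_dist n c =
    expect n (\<lambda>t. if accepted t then if map out t = c then 1 else 0 else 1 / 2 ^ n)"

lemma sum_bitstrings_output:
  "length t = n \<Longrightarrow> (\<Sum>c\<in>bitstrings n. if map out t = c then a else 0) = (a::real)"
  using finite_bitstrings[of n] by (simp add: bitstrings_def)

lemma sum_output_dist: "(\<Sum>c\<in>bitstrings n. output_dist n c) = 1"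
proof -
  have "(\<Sum>c\<in>bitstrings n. output_dist n c) = expect n (\<lambda>t. \<Sum>c\<in>bitstrings n.
      if accepted t then if map out t = c then 1 else 0 else 1 / 2 ^ n)"
    unfolding output_dist_def by (rule expect_sum[symmetric])
  also have "\<dots> = expect n (\<lambda>_. 1)"
  proof (rule expect_cong)
    fix t :: "'r list" assume "length t = n"
    then show "(\<Sum>c\<in>bitstrings n.
        if accepted t then if map out t = c then 1 else 0 else 1 / 2 ^ n) = (1::real)"
      by (cases "accepted t") (simp_all add: sum_bitstrings_output card_bitstrings)
  qed
  finally show ?thesis by (simp add: expect_const)
qed

definition regular_output :: "nat \<Rightarrow> real \<Rightarrow> bool list \<Rightarrow> real" where
  "regular_output n \<Delta> c = expect n (\<lambda>t. if accepted t
    then if map out t = c \<and> compensator t \<le> real n * \<epsilon> + \<Delta> then 1 else 0 else 1 / 2 ^ n)"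

definition irregular_output :: "nat \<Rightarrow> real \<Rightarrow> bool list \<Rightarrow> real" where
  "irregular_output n \<Delta> c = expect n (\<lambda>t. if map out t = c
    then if accepted t \<and> real n * \<epsilon> + \<Delta> < compensator t then 1 else 0 else 0)"

lemma output_dist_split: "output_dist n c = regular_output n \<Delta> c + irregular_output n \<Delta> c"
  unfolding output_dist_def regular_output_def irregular_output_def expect_add[symmetric]
  by (rule expect_cong) auto

lemma regular_output_nonneg: "0 \<le> regular_output n \<Delta> c"
  using expect_mono[of n "\<lambda>_. 0"] by (simp add: regular_output_def expect_const)

lemma irregular_output_nonneg: "0 \<le> irregular_output n \<Delta> c"
  using expect_mono[of n "\<lambda>_. 0"] by (simp add: irregular_output_def expect_const)

lemma inverse_power_le_guess:
  assumes "0 \<le> \<Delta>"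
  shows "1 / 2 ^ n \<le> exp (\<alpha> / guess_rate * \<Delta>) * guess_rate ^ n"
proof -
  have "1 * (1/2) ^ n \<le> exp (\<alpha> / guess_rate * \<Delta>) * guess_rate ^ n"
    using guess_rate_ge_half assms coeffs_nonneg by (intro mult_mono power_mono) auto
  then show ?thesis by (simp add: power_one_over)
qed

lemma regular_output_le:
  assumes "length c = n" "0 \<le> \<Delta>"
  shows "regular_output n \<Delta> c \<le> 2 * (exp (\<alpha> / guess_rate * \<Delta>) * guess_rate ^ n)"
proof -
  have "regular_output n \<Delta> c \<le>
      expect n (\<lambda>t. (if map out t = c \<and> compensator t \<le> real n * \<epsilon> + \<Delta> then 1 else 0) + 1 / 2 ^ n)"
    unfolding regular_output_def by (rule expect_mono) simp
  then show ?thesis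
    using prob_output_low_compensator_le[OF assms(1), of \<Delta>]
      inverse_power_le_guess[OF assms(2), of n]
    by (simp add: expect_add expect_const)
qed

lemma sum_irregular_output_le:
  assumes "1 \<le> n" "0 \<le> \<Delta>"
  shows "(\<Sum>c\<in>bitstrings n. irregular_output n \<Delta> c) \<le> exp (- 2 * \<Delta>\<^sup>2 / real n)"
proof -
  have "(\<Sum>c\<in>bitstrings n. irregular_output n \<Delta> c) =
      expect n (\<lambda>t. if accepted t \<and> real n * \<epsilon> + \<Delta> < compensator t then 1 else 0)"
    unfolding irregular_output_def expect_sum[symmetric]
    by (rule expect_cong) (rule sum_bitstrings_output)
  also have "\<dots> \<le> expect n (\<lambda>t. if failures t + \<Delta> < compensator t then 1 else 0)"
    by (rule expect_mono) (simp add: accepted_def)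
  also have "\<dots> \<le> exp (- 2 * \<Delta>\<^sup>2 / real n)"
    by (rule prob_failures_below_compensator_le[OF assms])
  finally show ?thesis .
qed

lemma shannon_output_dist_ge:
  assumes "3 \<le> n"
  shows "- real n * log 2 guess_rate
      - (2 + 1 / ln 2 + \<alpha> / (guess_rate * ln 2)) * sqrt (real n * ln (real n)) \<le>
    shannon (output_dist n) (bitstrings n)"
proof -
  define \<Delta> where "\<Delta> = sqrt (real n * ln (real n))"
  define k where "k = 2 * (exp (\<alpha> / guess_rate * \<Delta>) * guess_rate ^ n)"
  define v where "v = (\<Sum>c\<in>bitstrings n. irregular_output n \<Delta> c)"
  have "1 * 1 \<le> real n * ln (real n)" using assms one_le_ln[OF assms] by (intro mult_mono) auto
  then have \<Delta>_bounds: "1 \<le> \<Delta>" "\<Delta>\<^sup>2 = real n * ln (real n)" by (simp_all add: \<Delta>_def)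
  have "v \<le> exp (- 2 * ln (real n))"
    using sum_irregular_output_le[of n \<Delta>] \<Delta>_bounds assms by (simp add: v_def)
  also have "\<dots> \<le> exp (- ln (real n))" using assms by simp
  finally have v_bounds: "0 \<le> v" "v \<le> 1 / real n"
    using assms
    by (simp_all add: v_def exp_minus inverse_eq_divide sum_nonneg irregular_output_nonneg)
  have log_k: "- log 2 k = - 1 - \<alpha> / (guess_rate * ln 2) * \<Delta> - real n * log 2 guess_rate"
    unfolding k_def log_def using guess_rate_ge_half
    by (simp add: ln_mult_pos ln_realpow add_divide_distrib)
  have "log 2 (1 / 2 ^ n) \<le> log 2 k"
    using inverse_power_le_guess[of \<Delta> n] \<Delta>_bounds guess_rate_ge_half
    unfolding k_def by (intro log_mono) (auto intro: order_trans)
  then have "- log 2 k \<le> real n" by (simp add: log_divide log_nat_power)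
  then have "v * (- log 2 k) \<le> v * real n" using v_bounds by (intro mult_left_mono) auto
  also have "\<dots> \<le> 1" using v_bounds assms by (simp add: pos_le_divide_eq)
  finally have "v * (- log 2 k) \<le> 1" .
  moreover have "1 / real n \<le> 1" using assms by simp
  then have "v / ln 2 \<le> 1 / ln 2" using v_bounds by (intro divide_right_mono) auto
  ultimately have "- log 2 k - 1 - 1 / ln 2 \<le> (1 - v) * (- log 2 k) - v / ln 2"
    by (simp add: algebra_simps)
  also have "\<dots> \<le> shannon (output_dist n) (bitstrings n)"
    unfolding v_def k_def
    by (rule shannon_ge_of_bounded_part[OF finite_bitstrings output_dist_split regular_output_nonneg
          regular_output_le irregular_output_nonneg sum_output_dist])
       (use \<Delta>_bounds in \<open>auto simp: bitstrings_def\<close>)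
  finally have "- log 2 k - 1 - 1 / ln 2 \<le> shannon (output_dist n) (bitstrings n)" .
  moreover have "(2 + 1 / ln 2) * 1 \<le> (2 + 1 / ln 2) * \<Delta>"
    using \<Delta>_bounds by (intro mult_left_mono) auto
  ultimately show ?thesis unfolding log_k \<Delta>_def[symmetric] by (simp add: algebra_simps)
qed

end

subsection \<open>Guessing bits one at a time\<close>

locale bit_process = path_process p for p :: "bool list \<Rightarrow> real" +
  fixes \<kappa> :: real
  assumes p_snoc_le: "p (x @ [y]) \<le> \<kappa> * p x"
begin

lemma expect_agreements_le: "expect n (agreements c) \<le> real n * \<kappa>"
proof -
  have "(\<Sum>y\<in>UNIV. p (x @ [y]) * agreements c (x @ [y])) \<le> p x * (agreements c x + \<kappa>)" for x
  proof -
    have "(\<Sum>y\<in>UNIV. p (x @ [y]) * agreements c (x @ [y])) =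
        (\<Sum>y\<in>UNIV. p (x @ [y])) * agreements c x + p (x @ [c ! length x])"
      by (cases "c ! length x") (simp_all add: agreements_snoc UNIV_bool algebra_simps)
    then show ?thesis
      using p_snoc_le[of x "c ! length x"] by (simp add: sum_p_snoc algebra_simps)
  qed
  from expect_le_linear[of "agreements c", OF this] show ?thesis by (simp add: agreements_def)
qed

lemma shannon_ge:
  assumes "\<kappa> \<le> 1"
  shows "real n * bin_ent \<kappa> \<le> shannon p (bitstrings n)"
proof (induction n)
  case 0
  show ?case by (simp add: shannon_def bitstrings_def ent_term_def p_Nil)
next
  case (Suc n)
  have "(\<Sum>x\<in>bitstrings n. p x) = 1"
    using expect_const[of n 1] by (simp add: expect_def bitstrings_def)
  then have "real (Suc n) * bin_ent \<kappa> = real n * bin_ent \<kappa> + (\<Sum>x\<in>bitstrings n. p x) * bin_ent \<kappa>"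
    by (simp add: algebra_simps)
  also have "\<dots> \<le> (\<Sum>x\<in>bitstrings n. ent_term (p x) + p x * bin_ent \<kappa>)"
    using Suc.IH by (simp add: shannon_def sum.distrib sum_distrib_right)
  also have "\<dots> \<le> (\<Sum>x\<in>bitstrings n. \<Sum>y\<in>UNIV. ent_term (p (x @ [y])))"
  proof (rule sum_mono)
    fix x
    have "p x = p (x @ [True]) + p (x @ [False])"
      using sum_p_snoc[of x] by (simp add: UNIV_bool)
    then show "ent_term (p x) + p x * bin_ent \<kappa> \<le> (\<Sum>y\<in>UNIV. ent_term (p (x @ [y])))"
      using ent_term_split_ge[of "p (x @ [True])" \<kappa> "p (x @ [False])"] p_snoc_le[of x] assms
      by (simp add: UNIV_bool p_nonneg)
  qed
  also have "\<dots> = shannon p (bitstrings (Suc n))"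
    by (simp add: shannon_def bitstrings_def sum_lists_length_Suc)
  finally show ?case .
qed

end

subsection \<open>Transcripts\<close>

definition outbit :: "round \<Rightarrow> bool" where
  "outbit = (\<lambda>(a, b, f). a \<noteq> b)"

definition flag :: "round \<Rightarrow> bool" where
  "flag = (\<lambda>(a, b, f). f)"

lemma xor_out_eq_map: "xor_out t = map outbit t"
  by (simp add: xor_out_def outbit_def)

lemma accepts_iff: "accepts fstar t \<longleftrightarrow>
    real (length (filter (\<lambda>r. \<not> flag r) t)) \<le> real (length t) * (1 - fstar)"
proof -
  have "real (length (filter flag t)) + real (length (filter (\<lambda>r. \<not> flag r) t)) = real (length t)"
    using sum_length_filter_compl[of flag t] by linarith
  then show ?thesis by (auto simp: accepts_def flag_def algebra_simps)
qed

lemma sum_round: "(\<Sum>r\<in>UNIV. F r) = (\<Sum>a\<in>UNIV. \<Sum>b\<in>UNIV. \<Sum>f\<in>UNIV. F (a, b, f))"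
  for F :: "round \<Rightarrow> real"
  by (simp add: UNIV_Times_UNIV[symmetric] sum.cartesian_product' del: UNIV_Times_UNIV)

lemma sum_outbit: "(\<Sum>r | outbit r = y. F r) = (\<Sum>f\<in>UNIV. F (False, y, f) + F (True, \<not> y, f))"
  for F :: "round \<Rightarrow> real"
  unfolding sum_Collect_if sum_round by (cases y) (simp_all add: UNIV_bool outbit_def)

lemma sum_not_flag: "(\<Sum>r | \<not> flag r. F r) = (\<Sum>b\<in>UNIV. \<Sum>a\<in>UNIV. F (a, b, False))"
  for F :: "round \<Rightarrow> real"
  unfolding sum_Collect_if sum_round by (simp add: UNIV_bool flag_def)

subsection \<open>Honest parties\<close>

lemma pass_prob_bounds:
  assumes "unitvec d (\<psi> a)" "cptp d d EK"
  shows "0 \<le> pass_prob d \<psi> EK a" "pass_prob d \<psi> EK a \<le> 1"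
proof -
  let ?\<rho> = "kapply d EK (proj (\<psi> a))"
  have "psd d ?\<rho>" by (intro psd_kapply psd_proj)
  then show "0 \<le> pass_prob d \<psi> EK a" by (simp add: pass_prob_def psd_def)
  have "mtrace d ?\<rho> = 1"
    using assms by (simp add: mtrace_kapply_cptp mtrace_proj unitvec_vinner_self)
  then show "pass_prob d \<psi> EK a \<le> 1"
    using quadform_le_mtrace[OF \<open>psd d ?\<rho>\<close> assms(1)] by (simp add: pass_prob_def)
qed

lemma prob_honest_snoc:
  "prob_honest d \<psi> EK (t @ [(a, b, f)]) =
    prob_honest d \<psi> EK t * ((if f then pass_prob d \<psi> EK a else 1 - pass_prob d \<psi> EK a) / 4)"
  by (simp add: prob_honest_def)

context state_pair
begin

lemma chan_fid_bounds:
  assumes "cptp d d EK"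
  shows "0 \<le> chan_fid d \<psi> EK" "chan_fid d \<psi> EK \<le> 1"
  using pass_prob_bounds[of d \<psi>, OF unitvec_\<psi>[of True] assms]
    pass_prob_bounds[of d \<psi>, OF unitvec_\<psi>[of False] assms]
  by (simp_all add: chan_fid_def)

lemma path_process_prob_honest:
  assumes "cptp d d EK"
  shows "path_process (prob_honest d \<psi> EK)"
proof
  show "prob_honest d \<psi> EK [] = 1" by (simp add: prob_honest_def)
  show "0 \<le> prob_honest d \<psi> EK t" for t
    unfolding prob_honest_def using pass_prob_bounds[of d \<psi>, OF unitvec_\<psi> assms]
    by (intro prod_list_nonneg) auto
  show "(\<Sum>r\<in>UNIV. prob_honest d \<psi> EK (t @ [r])) = prob_honest d \<psi> EK t" for t
    unfolding sum_round by (simp add: UNIV_bool prob_honest_snoc field_simps)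
qed

lemma honest_pass_count_mgf:
  assumes "cptp d d EK" and "length c = n" and "0 \<le> g"
  shows "(\<Sum>t | length t = n. prob_honest d \<psi> EK t
      * (if xor_out t = c then g ^ length (filter flag t) else 0)) =
    ((1 - chan_fid d \<psi> EK + chan_fid d \<psi> EK * g) / 2) ^ n"
proof -
  interpret path_process "prob_honest d \<psi> EK" by (rule path_process_prob_honest[OF assms(1)])
  define X where
    "X t = (if map outbit t = take (length t) c then g ^ length (filter flag t) else 0)" for t
  have "expect n X = ((1 - chan_fid d \<psi> EK + chan_fid d \<psi> EK * g) / 2) ^ n * X []"
  proof (rule expect_eq_power)
    show "0 \<le> (1 - chan_fid d \<psi> EK + chan_fid d \<psi> EK * g) / 2"
      using chan_fid_bounds[OF assms(1)] assms(3) by simp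
    fix t :: "round list" assume len: "length t < n"
    have X_snoc: "X (t @ [r]) = X t
        * (if outbit r = c ! length t then if flag r then g else 1 else 0)" for r
      using snoc_eq_take_Suc_iff[of "map outbit t" c "outbit r"] len assms(2) by (simp add: X_def)
    show "(\<Sum>r\<in>UNIV. prob_honest d \<psi> EK (t @ [r]) * X (t @ [r])) =
        (1 - chan_fid d \<psi> EK + chan_fid d \<psi> EK * g) / 2 * (prob_honest d \<psi> EK t * X t)"
      unfolding sum_round X_snoc prob_honest_snoc
      by (cases "c ! length t")
         (simp_all add: UNIV_bool outbit_def flag_def chan_fid_def field_simps)
  qed
  moreover have "expect n X =
      (\<Sum>t | length t = n. prob_honest d \<psi> EK t
        * (if xor_out t = c then g ^ length (filter flag t) else 0))"
    unfolding expect_def using assms(2) by (intro sum.cong refl) (simp add: X_def xor_out_eq_map)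
  ultimately show ?thesis by (simp add: X_def)
qed

lemma honest_reject_prob_le:
  assumes "cptp d d EK" and "fstar \<le> chan_fid d \<psi> EK" and "length c = n"
  shows "(\<Sum>t | length t = n. prob_honest d \<psi> EK t
      * (if \<not> accepts fstar t \<and> xor_out t = c then 1 else 0)) \<le>
    exp (- 2 * real n * (chan_fid d \<psi> EK - fstar)\<^sup>2) / 2 ^ n"
proof -
  interpret path_process "prob_honest d \<psi> EK" by (rule path_process_prob_honest[OF assms(1)])
  let ?F = "chan_fid d \<psi> EK"
  define l where "l = 4 * (?F - fstar)"
  have l_nonneg: "0 \<le> l" using assms(2) by (simp add: l_def)
  have "expect n (\<lambda>t. if \<not> accepts fstar t \<and> xor_out t = c then 1 else 0) \<le>
      expect n (\<lambda>t. exp (l * (real n * fstar))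
        * (if xor_out t = c then exp (- l) ^ length (filter flag t) else 0))"
  proof (rule expect_mono)
    fix t :: "round list" assume len: "length t = n"
    have "1 \<le> exp (l * (real n * fstar)) * exp (- l) ^ length (filter flag t)"
      if "\<not> accepts fstar t"
    proof -
      have "0 \<le> l * (real n * fstar - real (length (filter flag t)))"
        using that l_nonneg len by (simp add: accepts_def flag_def)
      then show ?thesis by (simp add: exp_of_nat_mult[symmetric] exp_add[symmetric] algebra_simps)
    qed
    then show "(if \<not> accepts fstar t \<and> xor_out t = c then 1 else 0) \<le>
        exp (l * (real n * fstar))
          * (if xor_out t = c then exp (- l) ^ length (filter flag t) else 0)"
      by auto
  qed
  also have "\<dots> = exp (l * (real n * fstar)) * ((1 - ?F + ?F * exp (- l)) / 2) ^ n"
    unfolding expect_mult unfolding expect_def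
    by (simp only: honest_pass_count_mgf[OF assms(1,3)] exp_ge_zero)
  also have "\<dots> \<le> exp (l * (real n * fstar)) * (exp (l\<^sup>2 / 8 - l * ?F) / 2) ^ n"
    using chan_fid_bounds[OF assms(1)] l_nonneg
    by (intro mult_left_mono power_mono divide_right_mono bernoulli_mgf_le)
       (auto intro!: add_nonneg_nonneg divide_nonneg_nonneg)
  also have "\<dots> = exp (l * (real n * fstar) + real n * (l\<^sup>2 / 8 - l * ?F)) / 2 ^ n"
    by (simp add: power_divide exp_of_nat_mult exp_add)
  also have "l * (real n * fstar) + real n * (l\<^sup>2 / 8 - l * ?F) = - 2 * real n * (?F - fstar)\<^sup>2"
    by (simp add: l_def power2_eq_square field_simps)
  finally show ?thesis by (simp add: expect_def)
qed

lemma honest_xy_bounds: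
  assumes "cptp d d EK" and "fstar \<le> chan_fid d \<psi> EK" and "length c = n"
  defines "\<delta> \<equiv> exp (- real n * (chan_fid d \<psi> EK - fstar)\<^sup>2 / 2)"
  shows "(1 - \<delta>) / 2 ^ n \<le> honest_xy d \<psi> EK fstar n c"
    and "honest_xy d \<psi> EK fstar n c \<le> (1 + \<delta>) / 2 ^ n"
proof -
  interpret path_process "prob_honest d \<psi> EK" by (rule path_process_prob_honest[OF assms(1)])
  let ?reject = "expect n (\<lambda>t. if \<not> accepts fstar t \<and> xor_out t = c then 1 else 0)"
  have output_prob: "expect n (\<lambda>t. if xor_out t = c then 1 else 0) = 1 / 2 ^ n"
    using honest_pass_count_mgf[OF assms(1,3), of 1]
    by (simp add: expect_def power_one_over cong: if_cong)
  have "honest_xy d \<psi> EK fstar n c =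
      expect n (\<lambda>t. if accepts fstar t \<and> xor_out t = c then 1 else 0)"
    by (simp add: honest_xy_def transcripts_def expect_def)
  also have "\<dots> = expect n (\<lambda>t. (if xor_out t = c then 1 else 0)
      - (if \<not> accepts fstar t \<and> xor_out t = c then 1 else 0))"
    by (rule expect_cong) simp
  finally have split: "honest_xy d \<psi> EK fstar n c = 1 / 2 ^ n - ?reject"
    by (simp add: expect_diff output_prob)
  have "0 \<le> real n * (chan_fid d \<psi> EK - fstar)\<^sup>2" by simp
  then have "exp (- 2 * real n * (chan_fid d \<psi> EK - fstar)\<^sup>2) \<le> \<delta>"
    by (simp add: \<delta>_def)
  then have "?reject \<le> \<delta> / 2 ^ n"
    using honest_reject_prob_le[OF assms(1-3)] unfolding expect_def
    by (meson divide_right_mono order_trans zero_le_power zero_le_numeral)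
  then show "(1 - \<delta>) / 2 ^ n \<le> honest_xy d \<psi> EK fstar n c"
    by (simp add: split diff_divide_distrib)
  have "0 \<le> ?reject" using expect_mono[of n "\<lambda>_. 0"] by (simp add: expect_const)
  then show "honest_xy d \<psi> EK fstar n c \<le> (1 + \<delta>) / 2 ^ n"
    by (simp add: split add_divide_distrib \<delta>_def add_increasing2)
qed

end

subsection \<open>Dishonest Alice\<close>

lemma Re_mtrace_bproj: "Re (mtrace d (mmul d (bproj d \<psi> a f) A)) =
    (if f then Re (quadform d A (\<psi> a)) else fail_weight d A (\<psi> a))"
  by (simp add: bproj_def quadform_eq_mtrace mmul_diff_left mtrace_diff mtrace_mmul_idm
      fail_weight_def)

context state_pair
begin

lemma orth_proj_bproj: "orth_proj d (bproj d \<psi> a f)"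
  by (simp add: bproj_def orth_proj_proj orth_proj_complement unitvec_\<psi>)

abbreviation announcements :: "round list \<Rightarrow> (bool \<times> bool) list" where
  "announcements h \<equiv> map (\<lambda>(a, b, f). (a, b)) h"

definition prepared_state :: "astrat \<Rightarrow> round list \<Rightarrow> cmat" where
  "prepared_state S h = kapply (amem S) (aprep S (announcements h)) (stA d \<psi> S h)"

definition answered_state :: "astrat \<Rightarrow> round list \<Rightarrow> bool \<Rightarrow> bool \<Rightarrow> cmat" where
  "answered_state S h b a =
    kapply (amem S * d) (lift_kraus d (ameas S (announcements h) b a)) (prepared_state S h)"

text \<open>Bob's unnormalised system after he has announced \<open>b\<close> and Alice has answered \<open>a\<close>.\<close>
definition sent_state :: "astrat \<Rightarrow> round list \<Rightarrow> bool \<Rightarrow> bool \<Rightarrow> cmat" where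
  "sent_state S h b a = ptrace1 (amem S) d (answered_state S h b a)"

lemma stA_Cons: "stA d \<psi> S ((a, b, f) # h) =
   (let P = kron d d (idm (amem S)) (bproj d \<psi> a f);
        Z = answered_state S h b a
    in (\<lambda>i j. ptrace2 d (mmul (amem S * d) (mmul (amem S * d) P Z) P) i j / of_real 2))"
  by (simp add: answered_state_def prepared_state_def lift_kraus_def Let_def)

lemma psd_answered_state: "psd (amem S) (stA d \<psi> S h) \<Longrightarrow> psd (amem S * d) (answered_state S h b a)"
  unfolding answered_state_def prepared_state_def by (intro psd_kapply)

lemma psd_stA:
  assumes "valid_astrat d S"
  shows "psd (amem S) (stA d \<psi> S h)"
proof (induction h)
  case Nil
  then show ?case using assms by (simp add: valid_astrat_def density_psd)
next
  case (Cons r h)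
  obtain a b f where r_eq: "r = (a, b, f)" by (cases r)
  show ?case
    unfolding r_eq stA_Cons Let_def
      orth_proj_conjugate(1)[OF orth_proj_kron_idm[OF orth_proj_bproj]]
    by (intro psd_divide psd_ptrace2 psd_kapply psd_answered_state Cons) simp
qed

lemma psd_sent_state: "valid_astrat d S \<Longrightarrow> psd d (sent_state S h b a)"
  unfolding sent_state_def by (intro psd_ptrace1 psd_answered_state psd_stA)

lemma Re_mtrace_stA_Cons: "Re (mtrace (amem S) (stA d \<psi> S ((a, b, f) # h))) =
    (if f then Re (quadform d (sent_state S h b a) (\<psi> a))
     else fail_weight d (sent_state S h b a) (\<psi> a)) / 2"
  unfolding stA_Cons Let_def mtrace_divide mtrace_ptrace2_orth_proj[OF orth_proj_bproj]
    sent_state_def[symmetric]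
  by (simp add: Re_mtrace_bproj)

lemma sent_state_ensemble:
  assumes "valid_astrat d S" "k < d" "l < d"
  shows "sent_state S h b False k l + sent_state S h b True k l =
      ptrace1 (amem S) d (prepared_state S h) k l"
  unfolding sent_state_def answered_state_def
  using assms by (intro ptrace1_instrument2) (auto simp: valid_astrat_def)

lemma mtrace_prepared_state:
  "valid_astrat d S \<Longrightarrow> mtrace d (ptrace1 (amem S) d (prepared_state S h)) =
      mtrace (amem S) (stA d \<psi> S h)"
  unfolding mtrace_ptrace1 prepared_state_def
  by (rule mtrace_kapply_cptp) (simp add: valid_astrat_def)

lemma probA_snoc: "probA d \<psi> S (x @ [(a, b, f)]) =
    (if f then Re (quadform d (sent_state S (rev x) b a) (\<psi> a))
     else fail_weight d (sent_state S (rev x) b a) (\<psi> a)) / 2"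
  by (simp add: probA_def Re_mtrace_stA_Cons del: stA.simps)

lemma probA_eq_mtrace_prepared_state:
  assumes "valid_astrat d S"
  shows "probA d \<psi> S x = Re (mtrace d (ptrace1 (amem S) d (prepared_state S (rev x))))"
  by (simp add: probA_def mtrace_prepared_state[OF assms])

lemma sum_mtrace_sent_state:
  assumes "valid_astrat d S"
  shows "Re (mtrace d (sent_state S (rev x) b False)) +
    Re (mtrace d (sent_state S (rev x) b True)) = probA d \<psi> S x"
  using mtrace_sum_cong[OF sent_state_ensemble[OF assms]]
  by (simp add: probA_eq_mtrace_prepared_state[OF assms] flip: plus_complex.sel)

lemma path_process_probA:
  assumes "valid_astrat d S"
  shows "path_process (probA d \<psi> S)"
proof
  show "probA d \<psi> S [] = 1"
    using assms by (simp add: probA_def valid_astrat_def density_def)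
  show "0 \<le> probA d \<psi> S x" for x
    unfolding probA_def by (intro psd_mtrace_nonneg psd_stA assms)
  show "(\<Sum>r\<in>UNIV. probA d \<psi> S (x @ [r])) = probA d \<psi> S x" for x
    using sum_mtrace_sent_state[OF assms, of x False] sum_mtrace_sent_state[OF assms, of x True]
    unfolding sum_round by (simp add: UNIV_bool probA_snoc fail_weight_def field_simps)
qed

definition guess_bound :: "real \<Rightarrow> real" where
  "guess_bound \<epsilon> = 1/2 + sqrt \<epsilon> / (sqrt 2 * (sin \<theta>)\<^sup>2) + \<epsilon> / (sin \<theta>)\<^sup>2"

text \<open>Slope and intercept, the latter reduced by \<open>1/2\<close>, of the tangent to \<open>guess_bound\<close> at \<open>\<epsilon>\<close>.\<close>
definition tangent_slope :: "real \<Rightarrow> real" where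
  "tangent_slope \<epsilon> = 1 / (4 * sqrt (\<epsilon> / 2) * (sin \<theta>)\<^sup>2) + 1 / (sin \<theta>)\<^sup>2"

definition tangent_offset :: "real \<Rightarrow> real" where
  "tangent_offset \<epsilon> = sqrt (\<epsilon> / 2) / (2 * (sin \<theta>)\<^sup>2)"

lemma tangent_coeffs_nonneg: "0 < \<epsilon> \<Longrightarrow> 0 \<le> tangent_slope \<epsilon>" "0 < \<epsilon> \<Longrightarrow> 0 \<le> tangent_offset \<epsilon>"
  by (simp_all add: tangent_slope_def tangent_offset_def)

lemma tangent_eq_guess_bound:
  assumes "0 < \<epsilon>"
  shows "1/2 + tangent_offset \<epsilon> + tangent_slope \<epsilon> * \<epsilon> = guess_bound \<epsilon>"
proof -
  define t where "t = sqrt (\<epsilon> / 2)"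
  have t_props: "0 < t" "\<epsilon> = 2 * t\<^sup>2" using assms by (simp_all add: t_def)
  have "sqrt \<epsilon> / (sqrt 2 * (sin \<theta>)\<^sup>2) = t / (sin \<theta>)\<^sup>2" by (simp add: t_def real_sqrt_divide)
  moreover have "\<epsilon> / (4 * t * (sin \<theta>)\<^sup>2) = t / (2 * (sin \<theta>)\<^sup>2)"
    using t_props by (simp add: power2_eq_square)
  ultimately show ?thesis
    by (simp add: guess_bound_def tangent_slope_def tangent_offset_def t_def[symmetric]
        distrib_right)
qed

lemma tested_process_probA:
  assumes valid: "valid_astrat d S" and "0 < \<epsilon>"
  shows "tested_process (probA d \<psi> S) outbit flag (tangent_slope \<epsilon>) (tangent_offset \<epsilon>) \<epsilon>"
proof (intro tested_process.intro path_process_probA[OF valid] tested_process_axioms.intro)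
  show "0 \<le> tangent_slope \<epsilon>" "0 \<le> tangent_offset \<epsilon>" "0 \<le> \<epsilon>"
    using assms tangent_coeffs_nonneg by auto
  fix x y
  define t where "t = sqrt (\<epsilon> / 2)"
  define \<sigma> where "\<sigma> = sent_state S (rev x)"
  define err where "err = (\<Sum>b\<in>UNIV. \<Sum>a\<in>UNIV. fail_weight d (\<sigma> b a) (\<psi> a))"
  have t_pos: "0 < t" using assms by (simp add: t_def)
  have "(sin \<theta>)\<^sup>2 *
        (Re (mtrace d (\<sigma> y False)) + Re (mtrace d (\<sigma> (\<not> y) (\<not> False))) - probA d \<psi> S x) \<le>
      t * probA d \<psi> S x + err / (4 * t) + err"
    unfolding err_def probA_eq_mtrace_prepared_state[OF valid]
    by (rule cheating_weight_le[where \<sigma> = \<sigma>])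
       (simp_all add: \<sigma>_def psd_sent_state valid sent_state_ensemble t_pos)
  then have "Re (mtrace d (\<sigma> y False)) + Re (mtrace d (\<sigma> (\<not> y) True)) - probA d \<psi> S x \<le>
      (t * probA d \<psi> S x + err / (4 * t) + err) / (sin \<theta>)\<^sup>2"
    using sin_\<theta>_pos by (simp add: pos_le_divide_eq mult.commute)
  moreover have "(\<Sum>r | outbit r = y. probA d \<psi> S (x @ [r])) =
      (Re (mtrace d (\<sigma> y False)) + Re (mtrace d (\<sigma> (\<not> y) True))) / 2"
    unfolding sum_outbit by (simp add: UNIV_bool probA_snoc fail_weight_def \<sigma>_def field_simps)
  ultimately have "(\<Sum>r | outbit r = y. probA d \<psi> S (x @ [r])) \<le>
      (probA d \<psi> S x + (t * probA d \<psi> S x + err / (4 * t) + err) / (sin \<theta>)\<^sup>2) / 2"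
    by (simp add: diff_le_eq add.commute)
  also have "\<dots> = (1/2 + tangent_offset \<epsilon>) * probA d \<psi> S x + tangent_slope \<epsilon> * (err / 2)"
    unfolding tangent_offset_def tangent_slope_def t_def[symmetric]
    by (simp add: algebra_simps add_divide_distrib)
  also have "err / 2 = (\<Sum>r | \<not> flag r. probA d \<psi> S (x @ [r]))"
    unfolding sum_not_flag err_def sum_divide_distrib by (simp add: probA_snoc \<sigma>_def)
  finally show "(\<Sum>r | outbit r = y. probA d \<psi> S (x @ [r])) \<le>
      (1/2 + tangent_offset \<epsilon>) * probA d \<psi> S x
      + tangent_slope \<epsilon> * (\<Sum>r | \<not> flag r. probA d \<psi> S (x @ [r]))" .
qed

lemma avgA_le:
  assumes valid: "valid_astrat d S" and "fstar < 1" and n_ge: "3 \<le> n"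
  shows "avgA d \<psi> fstar n S c \<le> guess_bound (1 - fstar)
      + (1/2 + tangent_slope (1 - fstar) + tangent_offset (1 - fstar))
        * sqrt (ln (real n) / real n)"
    (is "_ \<le> _ + ?C * _")
proof -
  have \<epsilon>_pos: "0 < 1 - fstar" using assms by simp
  interpret tested_process "probA d \<psi> S" outbit flag "tangent_slope (1 - fstar)"
      "tangent_offset (1 - fstar)" "1 - fstar"
    by (rule tested_process_probA[OF valid \<epsilon>_pos])
  have "avgA d \<psi> fstar n S c = 1 / real n
      * expect n (\<lambda>t. if accepted t then agreements c (map outbit t) else 0)"
    unfolding avgA_def transcripts_def xor_out_eq_map sum_prob_agreements expect_def
      accepted_def failures_def accepts_iff ..
  also have "\<dots> \<le> 1 / real n * (real n * guess_rate + ?C * sqrt (real n))"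
    by (intro mult_left_mono expect_accepted_agreements_le) simp
  also have "\<dots> = guess_rate + ?C * (sqrt (real n) / real n)"
    using n_ge by (simp add: field_simps)
  also have "\<dots> = guess_bound (1 - fstar) + ?C * sqrt (1 / real n)"
    unfolding guess_rate_def tangent_eq_guess_bound[OF \<epsilon>_pos]
    by (simp add: sqrt_divide_self_eq real_sqrt_divide inverse_eq_divide)
  also have "\<dots> \<le> guess_bound (1 - fstar) + ?C * sqrt (ln (real n) / real n)"
    using one_le_ln[OF n_ge] coeffs_nonneg
    by (intro add_left_mono mult_left_mono) (auto intro: divide_right_mono)
  finally show ?thesis .
qed

lemma shannon_ydistA_ge:
  assumes valid: "valid_astrat d S" and "fstar < 1" and n_ge: "3 \<le> n"
  defines "G \<equiv> guess_bound (1 - fstar)"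
  shows "- real n * log 2 G
      - (2 + 1 / ln 2 + tangent_slope (1 - fstar) / (G * ln 2)) * sqrt (real n * ln (real n)) \<le>
    shannon (ydistA d \<psi> fstar n S) (bitstrings n)"
proof -
  have \<epsilon>_pos: "0 < 1 - fstar" using assms by simp
  interpret tested_process "probA d \<psi> S" outbit flag "tangent_slope (1 - fstar)"
      "tangent_offset (1 - fstar)" "1 - fstar"
    by (rule tested_process_probA[OF valid \<epsilon>_pos])
  have "ydistA d \<psi> fstar n S = output_dist n"
    unfolding ydistA_def[abs_def] output_dist_def[abs_def] expect_def transcripts_def xor_out_eq_map
      accepted_def failures_def accepts_iff ..
  moreover have "guess_rate = G"
    unfolding G_def guess_rate_def by (rule tangent_eq_guess_bound[OF \<epsilon>_pos])
  ultimately show ?thesis using shannon_output_dist_ge[OF n_ge] by simp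
qed

lemma alice_bounds:
  assumes "fstar < 1"
  shows "\<exists>C N. \<forall>n\<ge>N. \<forall>S. valid_astrat d S \<longrightarrow>
    (\<forall>c. length c = n \<longrightarrow>
      avgA d \<psi> fstar n S c \<le> guess_bound (1 - fstar) + C * sqrt (ln (real n) / real n)) \<and>
    - real n * log 2 (guess_bound (1 - fstar)) - C * sqrt (real n * ln (real n)) \<le>
      shannon (ydistA d \<psi> fstar n S) (bitstrings n)"
proof -
  define \<epsilon> where "\<epsilon> = 1 - fstar"
  define A where "A = 1/2 + tangent_slope \<epsilon> + tangent_offset \<epsilon>"
  define B where "B = 2 + 1 / ln 2 + tangent_slope \<epsilon> / (guess_bound \<epsilon> * ln 2)"
  have max_bound: "A * sqrt x \<le> max A B * sqrt x" "B * sqrt x \<le> max A B * sqrt x" if "0 \<le> x" for x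
    using that by (simp_all add: mult_right_mono)
  show ?thesis
  proof (intro exI[of _ "max A B"] exI[of _ "3::nat"] allI impI conjI)
    fix n :: nat and S assume n_ge: "3 \<le> n" and valid: "valid_astrat d S"
    have ln_nonneg: "0 \<le> ln (real n)" using one_le_ln[OF n_ge] by simp
    show "- real n * log 2 (guess_bound (1 - fstar)) - max A B * sqrt (real n * ln (real n)) \<le>
        shannon (ydistA d \<psi> fstar n S) (bitstrings n)"
      using shannon_ydistA_ge[OF valid assms n_ge] max_bound(2)[of "real n * ln (real n)"] ln_nonneg
      by (simp add: B_def \<epsilon>_def)
    show "avgA d \<psi> fstar n S c \<le>
      guess_bound (1 - fstar) + max A B * sqrt (ln (real n) / real n)" for c
      using avgA_le[OF valid assms n_ge, of c] max_bound(1)[of "ln (real n) / real n"] ln_nonneg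
      by (simp add: A_def \<epsilon>_def)
  qed
qed

end

subsection \<open>Dishonest Bob\<close>

text \<open>The Kraus operator adjoins a system in the state \<open>v\<close>.\<close>
lemma kron_proj_eq_kapply:
  assumes "i < m * d" "j < m * d"
  shows "kron d d \<rho> (proj v) i j = kapply m [\<lambda>i k. idm m (i div d) k * v (i mod d)] \<rho> i j"
proof -
  have "0 < d" using assms by (cases "d = 0") auto
  then have "i div d < m" "j div d < m"
    using assms by (simp_all add: div_less_iff_less_mult)
  have "cnj (idm m k l) = idm m k l" for k l
    by (simp add: idm_def)
  then have expand: "kapply m [\<lambda>i k. idm m (i div d) k * v (i mod d)] \<rho> i j =
      (\<Sum>l<m. idm m (j div d) l
        * ((\<Sum>k<m. idm m (i div d) k * (v (i mod d) * \<rho> k l)) * cnj (v (j mod d))))"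
    by (simp add: kapply_def mmul_def adj_def mult_ac)
  show ?thesis
    using \<open>i div d < m\<close> \<open>j div d < m\<close>
    unfolding expand sum_idm_left by (simp add: kron_def proj_def mult_ac)
qed

lemma psd_kron_proj: "psd m \<rho> \<Longrightarrow> psd (m * d) (kron d d \<rho> (proj v))"
  by (rule psd_cong[OF psd_kapply]) (auto simp: kron_proj_eq_kapply)

lemma mtrace_kron_proj: "mtrace (m * d) (kron d d \<rho> (proj v)) = mtrace m \<rho> * vinner d v v"
proof -
  have "mtrace (m * d) (kron d d \<rho> (proj v)) = (\<Sum>i<m. \<Sum>k<d. \<rho> i i * (cnj (v k) * v k))"
    unfolding mtrace_def sum_prod_index by (intro sum.cong refl) (simp add: kron_def proj_def)
  then show ?thesis by (simp add: mtrace_def vinner_def sum_product)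
qed

lemma psd_stB:
  assumes "valid_bstrat d S"
  shows "psd (bmem S) (stB d \<psi> S h)"
proof (induction h)
  case Nil
  then show ?case using assms by (simp add: valid_bstrat_def density_psd)
next
  case (Cons r h)
  obtain a b where r_eq: "r = (a, b)" by (cases r)
  have "psd (bmem S) (\<lambda>i j.
      kapply (bmem S * d) (binst S h b) (kron d d (stB d \<psi> S h) (proj (\<psi> a))) i j / of_real 2)"
    by (intro psd_divide psd_kapply psd_kron_proj Cons) simp
  then show ?case unfolding r_eq by simp
qed

definition effect :: "nat \<Rightarrow> nat \<Rightarrow> cmat list \<Rightarrow> cmat \<Rightarrow> cmat" where
  "effect m d Ks \<rho> = ptrace1 m d (mmul (m * d) (kraus_sum m Ks) (kron d d \<rho> (idm d)))"

lemma quadform_effect: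
  "quadform d (effect m d Ks \<rho>) v = mtrace m (kapply (m * d) Ks (kron d d \<rho> (proj v)))"
proof -
  let ?E = "kraus_sum m Ks" and ?R = "kron d d \<rho> (idm d)" and ?V = "kron d d (idm m) (proj v)"
  have "quadform d (effect m d Ks \<rho>) v = mtrace (m * d) (mmul (m * d) ?V (mmul (m * d) ?E ?R))"
    unfolding quadform_eq_mtrace effect_def by (rule mtrace_mmul_kron_idm[symmetric])
  also have "\<dots> = mtrace (m * d) (mmul (m * d) ?E (mmul (m * d) ?R ?V))"
    unfolding mtrace_mmul_commute[of "m * d" "m * d" ?V] by (simp only: mmul_assoc)
  also have "\<dots> = mtrace (m * d) (mmul (m * d) ?E (kron d d \<rho> (proj v)))"
  proof (rule mtrace_mmul_cong)
    fix i j assume "i < m * d" "j < m * d"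
    moreover from this have "0 < d" by (cases "d = 0") auto
    ultimately have "j div d < m" "i mod d < d" by (simp_all add: div_less_iff_less_mult)
    then show "mmul (m * d) ?R ?V i j = kron d d \<rho> (proj v) i j"
      unfolding mmul_kron by (simp add: kron_def mmul_def sum_idm_left sum_idm_right)
  qed
  finally show ?thesis by (simp add: mtrace_kapply)
qed

lemma psd_effect: "psd m \<rho> \<Longrightarrow> psd d (effect m d Ks \<rho>)"
  unfolding psd_def[of d] quadform_effect by (intro allI psd_mtrace_nonneg psd_kapply psd_kron_proj)

lemma Re_quadform_effect_sum:
  assumes "instrument2 (m * d) m Kf"
  shows "Re (quadform d (effect m d (Kf False) \<rho>) v) + Re (quadform d (effect m d (Kf True) \<rho>) v) =
    Re (mtrace m \<rho>) * Re (vinner d v v)"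
proof -
  have "quadform d (effect m d (Kf False) \<rho>) v + quadform d (effect m d (Kf True) \<rho>) v =
      mtrace m \<rho> * vinner d v v"
    unfolding quadform_effect mtrace_kapply_instrument2[OF assms] by (rule mtrace_kron_proj)
  then show ?thesis by (simp add: vinner_self flip: plus_complex.sel)
qed

definition outbitB :: "bool \<times> bool \<Rightarrow> bool" where
  "outbitB = (\<lambda>(a, b). a \<noteq> b)"

lemma xor_outB_eq_map: "xor_outB t = map outbitB t"
  by (simp add: xor_outB_def outbitB_def)

lemma sum_roundB: "(\<Sum>r\<in>UNIV. F r) = (\<Sum>b\<in>UNIV. \<Sum>a\<in>UNIV. F (a, b))"
  for F :: "bool \<times> bool \<Rightarrow> real"
  by (simp add: UNIV_Times_UNIV[symmetric] sum.cartesian_product' UNIV_bool del: UNIV_Times_UNIV)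

lemma sum_outbitB: "(\<Sum>r | outbitB r = y. F r) = F (False, y) + F (True, \<not> y)"
  for F :: "bool \<times> bool \<Rightarrow> real"
  unfolding sum_Collect_if sum_roundB by (cases y) (simp_all add: UNIV_bool outbitB_def)

context state_pair
begin

definition reply_effect :: "bstrat \<Rightarrow> (bool \<times> bool) list \<Rightarrow> bool \<Rightarrow> cmat" where
  "reply_effect S h b = effect (bmem S) d (binst S h b) (stB d \<psi> S h)"

lemma probB_snoc: "probB d \<psi> S (x @ [(a, b)]) =
    Re (quadform d (reply_effect S (rev x) b) (\<psi> a)) / 2"
  by (simp add: probB_def reply_effect_def quadform_effect mtrace_divide)

lemma psd_reply_effect: "valid_bstrat d S \<Longrightarrow> psd d (reply_effect S h b)"
  unfolding reply_effect_def by (intro psd_effect psd_stB)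

lemma reply_effect_sum:
  assumes "valid_bstrat d S"
  shows "Re (quadform d (reply_effect S (rev x) b) v)
      + Re (quadform d (reply_effect S (rev x) (\<not> b)) v) =
    probB d \<psi> S x * Re (vinner d v v)"
proof -
  have "instrument2 (bmem S * d) (bmem S) (binst S (rev x))"
    using assms by (simp add: valid_bstrat_def)
  from Re_quadform_effect_sum[OF this, of "stB d \<psi> S (rev x)" v] show ?thesis
    by (cases b) (simp_all add: reply_effect_def probB_def add.commute)
qed

lemma path_process_probB:
  assumes "valid_bstrat d S"
  shows "path_process (probB d \<psi> S)"
proof
  show "probB d \<psi> S [] = 1"
    using assms by (simp add: probB_def valid_bstrat_def density_def)
  show "0 \<le> probB d \<psi> S x" for x
    unfolding probB_def by (intro psd_mtrace_nonneg psd_stB assms)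
  show "(\<Sum>r\<in>UNIV. probB d \<psi> S (x @ [r])) = probB d \<psi> S x" for x
    using reply_effect_sum[OF assms, of x False "\<psi> False"]
      reply_effect_sum[OF assms, of x False "\<psi> True"]
    unfolding sum_roundB
    by (simp add: UNIV_bool probB_snoc unitvec_vinner_self unitvec_\<psi> field_simps)
qed

lemma probB_guess_le:
  assumes "valid_bstrat d S"
  shows "(\<Sum>r | outbitB r = y. probB d \<psi> S (x @ [r])) \<le> (1 + sin \<theta>) / 2 * probB d \<psi> S x"
proof -
  let ?W = "\<lambda>b v. Re (quadform d (reply_effect S (rev x) b) v)"
  have "?W y v \<le> probB d \<psi> S x * Re (vinner d v v)" for v
  proof -
    have "0 \<le> ?W (\<not> y) v" using psd_reply_effect[OF assms] by (simp add: psd_def)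
    then show ?thesis using reply_effect_sum[OF assms, of x y v] by linarith
  qed
  then have "?W y (\<psi> False) - ?W y (\<psi> (\<not> False)) \<le> sin \<theta> * probB d \<psi> S x"
    by (intro helstrom_bound psd_reply_effect assms)
  moreover have "?W y (\<psi> True) + ?W (\<not> y) (\<psi> True) = probB d \<psi> S x"
    using reply_effect_sum[OF assms] by (simp add: unitvec_vinner_self unitvec_\<psi>)
  ultimately show ?thesis
    unfolding sum_outbitB by (simp add: probB_snoc field_simps)
qed

lemma bit_process_probB:
  assumes "valid_bstrat d S"
  shows "bit_process (push outbitB (probB d \<psi> S)) ((1 + sin \<theta>) / 2)"
proof (intro bit_process.intro bit_process_axioms.intro)
  show "path_process (push outbitB (probB d \<psi> S))"
    by (rule path_process.path_process_push[OF path_process_probB[OF assms]])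
  show "push outbitB (probB d \<psi> S) (x @ [y]) \<le>
      (1 + sin \<theta>) / 2 * push outbitB (probB d \<psi> S) x" for x y
    unfolding push_snoc unfolding push_def sum_distrib_left by (intro sum_mono probB_guess_le assms)
qed

lemma bob_bounds:
  assumes valid: "valid_bstrat d S" and n_ge: "1 \<le> n"
  shows "avgB d \<psi> n S c \<le> 1/2 + sin \<theta> / 2"
    and "real n * bin_ent ((1 + sin \<theta>) / 2) \<le> shannon (xdistB d \<psi> n S) (bitstrings n)"
proof -
  interpret bit_process "push outbitB (probB d \<psi> S)" "(1 + sin \<theta>) / 2"
    by (rule bit_process_probB[OF valid])
  have "avgB d \<psi> n S c = 1 / real n * expect n (agreements c)"
    using sum_prob_agreements[where P = "\<lambda>_. True" and out = outbitB]
    by (simp add: avgB_def transcriptsB_def xor_outB_eq_map expect_def sum_push)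
  also have "\<dots> \<le> 1 / real n * (real n * ((1 + sin \<theta>) / 2))"
    by (intro mult_left_mono expect_agreements_le) simp
  finally show "avgB d \<psi> n S c \<le> 1/2 + sin \<theta> / 2" using n_ge by (simp add: add_divide_distrib)
  have "xdistB d \<psi> n S x = push outbitB (probB d \<psi> S) x" if "x \<in> bitstrings n" for x
    using that unfolding xdistB_def push_def xor_outB_eq_map transcriptsB_def
    by (intro sum.mono_neutral_cong_right finite_lists_length) (auto simp: bitstrings_def)
  then show "real n * bin_ent ((1 + sin \<theta>) / 2) \<le> shannon (xdistB d \<psi> n S) (bitstrings n)"
    using shannon_ge[of n] by (simp add: shannon_def)
qed

end

theorem theorem4:
  fixes d :: nat and \<psi> :: "bool \<Rightarrow> cvec" and \<theta> fstar :: real and EK :: "cmat list"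
  assumes "unitvec d (\<psi> False)" and "unitvec d (\<psi> True)"
    and "(cmod (vinner d (\<psi> False) (\<psi> True)))\<^sup>2 = (cos \<theta>)\<^sup>2"
    and "0 < \<theta>" and "\<theta> \<le> pi / 2"
    and "cptp d d EK"
    and "0 < fstar" and "fstar < chan_fid d \<psi> EK"
  shows
    "(\<forall>n::nat. 1 \<le> n \<longrightarrow> (\<forall>c. length c = n \<longrightarrow>
        (1 - exp (- real n * (chan_fid d \<psi> EK - fstar)\<^sup>2 / 2)) / 2 ^ n \<le> honest_xy d \<psi> EK fstar n c \<and>
        honest_xy d \<psi> EK fstar n c \<le> (1 + exp (- real n * (chan_fid d \<psi> EK - fstar)\<^sup>2 / 2)) / 2 ^ n))
   \<and> (\<exists>C N. \<forall>n::nat. N \<le> n \<longrightarrow> (\<forall>S. valid_astrat d S \<longrightarrow>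
        (\<forall>c. length c = n \<longrightarrow>
           avgA d \<psi> fstar n S c \<le> 1/2 + (sqrt (1 - fstar) / (sqrt 2 * (sin \<theta>)\<^sup>2)
              + (1 - fstar) / (sin \<theta>)\<^sup>2) + C * sqrt (ln (real n) / real n)) \<and>
        shannon (ydistA d \<psi> fstar n S) (bitstrings n) \<ge>
           - real n * log 2 (1/2 + sqrt (1 - fstar) / (sqrt 2 * (sin \<theta>)\<^sup>2)
              + (1 - fstar) / (sin \<theta>)\<^sup>2) - C * sqrt (real n * ln (real n))))
   \<and> (\<forall>n::nat. 1 \<le> n \<longrightarrow> (\<forall>S. valid_bstrat d S \<longrightarrow>
        (\<forall>c. length c = n \<longrightarrow> avgB d \<psi> n S c \<le> 1/2 + sin \<theta> / 2) \<and>
        shannon (xdistB d \<psi> n S) (bitstrings n) \<ge> real n * bin_ent ((1 + sin \<theta>) / 2)))"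
proof -
  have "unitvec d (\<psi> a)" for a
    using assms(1,2) by (cases a) simp_all
  then interpret state_pair d \<psi> \<theta>
    using assms(3-5) by unfold_locales auto
  have "fstar < 1" using chan_fid_bounds(2)[OF assms(6)] assms(8) by simp
  note alice = alice_bounds[OF \<open>fstar < 1\<close>, unfolded guess_bound_def add.assoc]
    and honest = honest_xy_bounds[OF assms(6) less_imp_le[OF assms(8)]]
  show ?thesis
    unfolding add.assoc by (intro conjI allI impI alice honest bob_bounds)
qed

end
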